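(* There is no matrix $V\in\mathbb{R}^{6\times n}$ such that $rk_t(V)=3$, $rk_K(V)>3$, every row of $\mathcal P(V)$ contains at least one $0$, and every column of $\mathcal P(V)$ has support $\{1,2\}$, $\{3,4\}$ or $\{5,6\}$.
   Context: Tropical rank $rk_t$: largest $r$ such that the matrix has an $r\times r$ submatrix $S$ for which $\min_{\sigma}\sum_i s_{i\sigma(i)}$ is attained by exactly one permutation. Kapranov rank $rk_K(B)$: minimal rank over $\mathbf K$ of a matrix $A\in\mathbf K^{m\times n}$ with $\deg a_{ij}=b_{ij}$, where $\mathbf K$ is the field of formal sums $\sum_{e\in\mathbb{R}}a_et^e$ ($a_e\in\mathbb{C}$) with well-ordered support and $\deg$ is the minimal exponent ($\deg 0=\infty$). The pattern $\mathcal P(A)\in\{0,\infty\}^{m\times n}$ has $(u,v)$ entry $0$ if $a_{uv}=\min_i a_{iv}$ and $\infty$ otherwise; the support of a column of $\mathcal P(A)$ is the set of row indices where it is $0$. *)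

theory Defs
  imports
    "HOL-Analysis.Analysis"
    "Jordan_Normal_Form.DL_Rank"
    "Jordan_Normal_Form.DL_Submatrix"
begin

section \<open>Well-ordered sets of real numbers\<close>

lemma wfp_on_real_iff:
  fixes S :: "real set"
  shows "wfp_on S (<) \<longleftrightarrow> \<not> (\<exists>s :: nat \<Rightarrow> real. \<forall>i. s i \<in> S \<and> s (Suc i) < s i)"
proof
  assume wf: "wfp_on S (<)"
  show "\<not> (\<exists>s :: nat \<Rightarrow> real. \<forall>i. s i \<in> S \<and> s (Suc i) < s i)"
  proof
    assume "\<exists>s :: nat \<Rightarrow> real. \<forall>i. s i \<in> S \<and> s (Suc i) < s i"
    then obtain s :: "nat \<Rightarrow> real" where s: "\<And>i. s i \<in> S" "\<And>i. s (Suc i) < s i"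
      by blast
    have "range s \<subseteq> S" "range s \<noteq> {}" using s by auto
    then obtain z where z: "z \<in> range s" "\<forall>y. y < z \<longrightarrow> y \<notin> range s"
      using wf unfolding wfp_on_iff_ex_minimal by meson
    then show False using s(2) by blast
  qed
next
  assume no: "\<not> (\<exists>s :: nat \<Rightarrow> real. \<forall>i. s i \<in> S \<and> s (Suc i) < s i)"
  show "wfp_on S (<)"
    unfolding wfp_on_iff_ex_minimal
  proof (intro allI impI, rule ccontr)
    fix B assume B: "B \<subseteq> S" "B \<noteq> {}" and n: "\<not> (\<exists>z\<in>B. \<forall>y. y < z \<longrightarrow> y \<notin> B)"
    obtain b where b: "b \<in> B" using B by blast
    have "\<exists>s. \<forall>i. s i \<in> B \<and> s (Suc i) < s i"
      by (rule dependent_nat_choice) (use b n in auto)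
    then show False using no B by blast
  qed
qed

lemma wo_incseq_subseq:
  fixes s :: "nat \<Rightarrow> real"
  assumes wf: "wfp_on S (<)" and s: "\<And>i. s i \<in> S"
  shows "\<exists>r. strict_mono r \<and> incseq (s \<circ> r)"
proof -
  obtain r :: "nat \<Rightarrow> nat" where r: "strict_mono r" "monoseq (\<lambda>n. s (r n))"
    using seq_monosub[of s] by blast
  show ?thesis
  proof (cases "incseq (\<lambda>n. s (r n))")
    case True
    then show ?thesis using r by (auto simp: o_def)
  next
    case False
    then have dec: "decseq (\<lambda>n. s (r n))" using r(2) by (simp add: monoseq_iff)
    let ?R = "range (\<lambda>n. s (r n))"
    have "?R \<subseteq> S" "?R \<noteq> {}" using s by auto
    then obtain z where z: "z \<in> ?R" "\<forall>y. y < z \<longrightarrow> y \<notin> ?R"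
      using wf unfolding wfp_on_iff_ex_minimal by meson
    then obtain N where N: "z = s (r N)" by blast
    have const: "s (r (N + k)) = z" for k
    proof -
      have "s (r (N + k)) \<le> s (r N)" using dec by (simp add: decseq_def)
      moreover have "\<not> s (r (N + k)) < z" using z(2) by blast
      ultimately show ?thesis using N by simp
    qed
    have "strict_mono (\<lambda>k. r (N + k))" using r(1) by (simp add: strict_mono_def)
    moreover have "incseq (s \<circ> (\<lambda>k. r (N + k)))" by (simp add: incseq_def const)
    ultimately show ?thesis by blast
  qed
qed

lemma wo_sumset:
  fixes A B :: "real set"
  assumes A: "wfp_on A (<)" and B: "wfp_on B (<)"
  shows "wfp_on {a + b |a b. a \<in> A \<and> b \<in> B} (<)"
  unfolding wfp_on_real_iff
proof
  assume "\<exists>s :: nat \<Rightarrow> real. \<forall>i. s i \<in> {a + b |a b. a \<in> A \<and> b \<in> B} \<and> s (Suc i) < s i"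
  then obtain s :: "nat \<Rightarrow> real"
    where s: "\<And>i. \<exists>a b. s i = a + b \<and> a \<in> A \<and> b \<in> B" "\<And>i. s (Suc i) < s i"
    by blast
  obtain a b where ab: "\<And>i. s i = a i + b i" "\<And>i. a i \<in> A" "\<And>i. b i \<in> B"
    using s(1) by metis
  obtain r where r: "strict_mono r" "incseq (a \<circ> r)"
    using wo_incseq_subseq[of A a, OF A ab(2)] by blast
  have dec: "s n < s m" if "m < n" for m n
    using that s(2) lift_Suc_mono_less[of "\<lambda>i. - s i" m n] by auto
  have "b (r (Suc i)) < b (r i)" for i
  proof -
    have "s (r (Suc i)) < s (r i)" using r(1) dec by (simp add: strict_mono_def)
    moreover have "a (r i) \<le> a (r (Suc i))" using r(2) by (simp add: incseq_Suc_iff)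
    ultimately show ?thesis using ab(1) by (simp add: less_le_trans)
  qed
  then have "\<exists>t :: nat \<Rightarrow> real. \<forall>i. t i \<in> B \<and> t (Suc i) < t i"
    using ab(3) by (intro exI[of _ "\<lambda>i. b (r i)"]) auto
  then show False using B unfolding wfp_on_real_iff by blast
qed

lemma wo_finite_fibre:
  fixes A B :: "real set"
  assumes A: "wfp_on A (<)" and B: "wfp_on B (<)"
  shows "finite {a. a \<in> A \<and> e - a \<in> B}"
proof (rule ccontr)
  assume "infinite {a. a \<in> A \<and> e - a \<in> B}"
  then obtain s :: "nat \<Rightarrow> real" where s: "inj s" "range s \<subseteq> {a. a \<in> A \<and> e - a \<in> B}"
    by (meson infinite_countable_subset)
  have sA: "s i \<in> A" "e - s i \<in> B" for i using s(2) by auto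
  obtain r where r: "strict_mono r" "incseq (s \<circ> r)"
    using wo_incseq_subseq[of A s, OF A sA(1)] by blast
  have "e - s (r (Suc i)) < e - s (r i)" for i
  proof -
    have "s (r i) \<le> s (r (Suc i))" using r(2) by (simp add: incseq_Suc_iff)
    moreover have "r i \<noteq> r (Suc i)" using r(1) by (simp add: strict_mono_eq)
    then have "s (r i) \<noteq> s (r (Suc i))" using s(1) by (simp add: inj_eq)
    ultimately show ?thesis by simp
  qed
  then have "\<exists>t :: nat \<Rightarrow> real. \<forall>i. t i \<in> B \<and> t (Suc i) < t i"
    using sA(2) by (intro exI[of _ "\<lambda>i. e - s (r i)"]) auto
  then show False using B unfolding wfp_on_real_iff by blast
qed

lemma wo_Un:
  fixes A B :: "real set"
  assumes A: "wfp_on A (<)" and B: "wfp_on B (<)"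
  shows "wfp_on (A \<union> B) (<)"
  unfolding wfp_on_iff_ex_minimal
proof (intro allI impI)
  fix C assume C: "C \<subseteq> A \<union> B" "C \<noteq> {}"
  have min: "\<exists>z\<in>D. \<forall>y\<in>D. z \<le> y" if "wfp_on S (<)" "D \<subseteq> S" "D \<noteq> {}" for S D :: "real set"
    using that unfolding wfp_on_iff_ex_minimal by (meson not_le)
  consider "C \<inter> A = {}" | "C \<inter> B = {}" | "C \<inter> A \<noteq> {}" "C \<inter> B \<noteq> {}" by blast
  then have "\<exists>z\<in>C. \<forall>y\<in>C. z \<le> y"
  proof cases
    case 1
    then show ?thesis using min[OF B, of C] C by blast
  next
    case 2
    then show ?thesis using min[OF A, of C] C by blast
  next
    case 3
    obtain x where x: "x \<in> C" "\<And>y. y \<in> C \<Longrightarrow> y \<in> A \<Longrightarrow> x \<le> y"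
      using min[OF A, of "C \<inter> A"] 3 by blast
    obtain y where y: "y \<in> C" "\<And>z. z \<in> C \<Longrightarrow> z \<in> B \<Longrightarrow> y \<le> z"
      using min[OF B, of "C \<inter> B"] 3 by blast
    have "min x y \<in> C" "\<forall>z\<in>C. min x y \<le> z"
      using x y C(1) by (auto simp: min_def intro: order_trans) (meson UnE in_mono nle_le order_trans)+
    then show ?thesis by blast
  qed
  then show "\<exists>z\<in>C. \<forall>y. y < z \<longrightarrow> y \<notin> C" by (meson not_le)
qed

lemma wo_finite: "finite (S :: real set) \<Longrightarrow> wfp_on S (<)"
  unfolding wfp_on_iff_ex_minimal
  by (metis Min_in Min_le finite_subset not_le)


section \<open>The field of generalized power series\<close>

text \<open>Formal sums \<open>\<Sum>\<^sub>e a\<^sub>e t\<^sup>e\<close> over real exponents \<open>e\<close>, represented by their coefficient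
  function. As \<open><\<close> is a strict linear order on the reals, well-foundedness of \<open><\<close> on the
  support says that the support is well-ordered.\<close>

typedef hahn = "{f :: real \<Rightarrow> complex. wfp_on {e. f e \<noteq> 0} (<)}"
  morphisms hcoeff Abs_hahn
  by (rule exI[of _ "\<lambda>_. 0"]) (simp add: wfp_on_iff_ex_minimal)

abbreviation hsupp :: "hahn \<Rightarrow> real set" where
  "hsupp f \<equiv> {e. hcoeff f e \<noteq> 0}"

lemma wo_hsupp: "wfp_on (hsupp f) (<)"
  using hcoeff[of f] by simp

lemma hcoeff_Abs: "wfp_on {e. f e \<noteq> 0} (<) \<Longrightarrow> hcoeff (Abs_hahn f) = f"
  by (simp add: Abs_hahn_inverse)

lemma hahn_eqI: "(\<And>e. hcoeff f e = hcoeff g e) \<Longrightarrow> f = g"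
  by (simp add: hcoeff_inject[symmetric] fun_eq_iff)

instantiation hahn :: "{zero, one, plus, minus, uminus, times}"
begin

definition "0 = Abs_hahn (\<lambda>_. 0)"

definition "1 = Abs_hahn (\<lambda>e. if e = 0 then 1 else 0)"

definition "f + g = Abs_hahn (\<lambda>e. hcoeff f e + hcoeff g e)"

definition "- f = Abs_hahn (\<lambda>e. - hcoeff f e)"

definition "f - g = Abs_hahn (\<lambda>e. hcoeff f e - hcoeff g e)"

text \<open>The Cauchy product: the index set below is finite because both supports are well-ordered.\<close>

definition "f * g = Abs_hahn (\<lambda>e. \<Sum>a | hcoeff f a \<noteq> 0 \<and> hcoeff g (e - a) \<noteq> 0.
                                  hcoeff f a * hcoeff g (e - a))"

instance ..

end

lemma hcoeff_0 [simp]: "hcoeff 0 e = 0"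
  unfolding zero_hahn_def by (subst hcoeff_Abs) (auto intro: wo_finite)

lemma hcoeff_1: "hcoeff 1 e = (if e = 0 then 1 else 0)"
  unfolding one_hahn_def by (subst hcoeff_Abs) (auto intro: wo_finite)

lemma hcoeff_add [simp]: "hcoeff (f + g) e = hcoeff f e + hcoeff g e"
  unfolding plus_hahn_def
  by (subst hcoeff_Abs) (auto intro!: wfp_on_subset[OF wo_Un[OF wo_hsupp[of f] wo_hsupp[of g]]])

lemma hcoeff_minus [simp]: "hcoeff (- f) e = - hcoeff f e"
  unfolding uminus_hahn_def by (subst hcoeff_Abs) (auto intro: wo_hsupp)

lemma hcoeff_diff [simp]: "hcoeff (f - g) e = hcoeff f e - hcoeff g e"
  unfolding minus_hahn_def
  by (subst hcoeff_Abs) (auto intro!: wfp_on_subset[OF wo_Un[OF wo_hsupp[of f] wo_hsupp[of g]]])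

lemma finite_hfibre: "finite {a. hcoeff f a \<noteq> 0 \<and> hcoeff g (e - a) \<noteq> 0}"
  using wo_finite_fibre[OF wo_hsupp[of f] wo_hsupp[of g], of e] by simp

lemma hcoeff_mult:
  "hcoeff (f * g) e = (\<Sum>a | hcoeff f a \<noteq> 0 \<and> hcoeff g (e - a) \<noteq> 0.
                          hcoeff f a * hcoeff g (e - a))"
proof -
  let ?h = "\<lambda>e. \<Sum>a | hcoeff f a \<noteq> 0 \<and> hcoeff g (e - a) \<noteq> 0. hcoeff f a * hcoeff g (e - a)"
  have "{e. ?h e \<noteq> 0} \<subseteq> {a + b |a b. a \<in> hsupp f \<and> b \<in> hsupp g}"
  proof
    fix e assume "e \<in> {e. ?h e \<noteq> 0}"
    then have "?h e \<noteq> 0" by simp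
    then have "{a. hcoeff f a \<noteq> 0 \<and> hcoeff g (e - a) \<noteq> 0} \<noteq> {}"
      by (metis (no_types, lifting) sum.empty)
    then obtain a where "hcoeff f a \<noteq> 0" "hcoeff g (e - a) \<noteq> 0" by blast
    moreover have "e = a + (e - a)" by simp
    ultimately show "e \<in> {a + b |a b. a \<in> hsupp f \<and> b \<in> hsupp g}" by blast
  qed
  then have "wfp_on {e. ?h e \<noteq> 0} (<)"
    using wfp_on_subset[OF wo_sumset[OF wo_hsupp[of f] wo_hsupp[of g]]] by blast
  then show ?thesis unfolding times_hahn_def by (subst hcoeff_Abs) auto
qed

lemma hcoeff_mult_sum:
  assumes "finite T" and "\<And>a. hcoeff f a \<noteq> 0 \<Longrightarrow> hcoeff g (e - a) \<noteq> 0 \<Longrightarrow> a \<in> T"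
  shows "hcoeff (f * g) e = (\<Sum>a\<in>T. hcoeff f a * hcoeff g (e - a))"
  unfolding hcoeff_mult by (rule sum.mono_neutral_left) (use assms in auto)

lemma hcoeff_mult_shift:
  assumes "finite C" and "\<And>c. hcoeff g (c - a) \<noteq> 0 \<Longrightarrow> hcoeff h (e - c) \<noteq> 0 \<Longrightarrow> c \<in> C"
  shows "hcoeff (g * h) (e - a) = (\<Sum>c\<in>C. hcoeff g (c - a) * hcoeff h (e - c))"
proof -
  have "hcoeff (g * h) (e - a) = (\<Sum>b\<in>(\<lambda>c. c - a) ` C. hcoeff g b * hcoeff h (e - a - b))"
  proof (rule hcoeff_mult_sum)
    show "finite ((\<lambda>c. c - a) ` C)" using assms(1) by simp
    fix b assume b: "hcoeff g b \<noteq> 0" "hcoeff h (e - a - b) \<noteq> 0"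
    have "b + a \<in> C" using b assms(2)[of "b + a"] by (simp add: algebra_simps)
    then show "b \<in> (\<lambda>c. c - a) ` C" by (metis add_diff_cancel_right' image_eqI)
  qed
  also have "\<dots> = (\<Sum>c\<in>C. hcoeff g (c - a) * hcoeff h (e - c))"
    by (subst sum.reindex) (auto simp: inj_on_def algebra_simps)
  finally show ?thesis .
qed

lemma hahn_mult_comm: "f * g = g * (f :: hahn)"
proof (rule hahn_eqI)
  fix e
  show "hcoeff (f * g) e = hcoeff (g * f) e"
    unfolding hcoeff_mult
    by (rule sum.reindex_bij_witness[of _ "\<lambda>a. e - a" "\<lambda>a. e - a"]) (auto simp: mult.commute)
qed

lemma hcoeff_mult_nonzeroD:
  assumes "hcoeff (f * g) e \<noteq> 0"
  obtains a where "hcoeff f a \<noteq> 0" "hcoeff g (e - a) \<noteq> 0"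
proof -
  have "{a. hcoeff f a \<noteq> 0 \<and> hcoeff g (e - a) \<noteq> 0} \<noteq> {}"
    using assms unfolding hcoeff_mult by (metis (no_types, lifting) sum.empty)
  then show ?thesis using that by blast
qed

lemma hahn_mult_assoc: "(f * g) * h = f * (g * (h :: hahn))"
proof (rule hahn_eqI)
  fix e
  define C where "C = {c. c \<in> {a + b |a b. a \<in> hsupp f \<and> b \<in> hsupp g} \<and> e - c \<in> hsupp h}"
  have finC: "finite C"
    unfolding C_def by (intro wo_finite_fibre wo_sumset wo_hsupp)
  have CI: "c \<in> C" if "hcoeff f a \<noteq> 0" "hcoeff g (c - a) \<noteq> 0" "hcoeff h (e - c) \<noteq> 0" for a c
  proof -
    have "c = a + (c - a)" by simp
    then show ?thesis using that unfolding C_def by blast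
  qed
  define A where "A = (\<Union>c\<in>C. {a. hcoeff f a \<noteq> 0 \<and> hcoeff g (c - a) \<noteq> 0})"
  have finA: "finite A" unfolding A_def using finC finite_hfibre by blast
  have Af: "hcoeff f a \<noteq> 0" if "a \<in> A" for a using that unfolding A_def by blast
  have "hcoeff ((f * g) * h) e = (\<Sum>c\<in>C. hcoeff (f * g) c * hcoeff h (e - c))"
    by (rule hcoeff_mult_sum[OF finC]) (auto elim!: hcoeff_mult_nonzeroD intro: CI)
  also have "\<dots> = (\<Sum>c\<in>C. (\<Sum>a\<in>A. hcoeff f a * hcoeff g (c - a)) * hcoeff h (e - c))"
  proof (rule sum.cong[OF refl])
    fix c assume c: "c \<in> C"
    have "hcoeff (f * g) c = (\<Sum>a\<in>A. hcoeff f a * hcoeff g (c - a))"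
      by (rule hcoeff_mult_sum[OF finA]) (use c in \<open>auto simp: A_def\<close>)
    then show "hcoeff (f * g) c * hcoeff h (e - c) =
               (\<Sum>a\<in>A. hcoeff f a * hcoeff g (c - a)) * hcoeff h (e - c)" by simp
  qed
  also have "\<dots> = (\<Sum>a\<in>A. \<Sum>c\<in>C. hcoeff f a * (hcoeff g (c - a) * hcoeff h (e - c)))"
    by (subst sum.swap) (simp add: sum_distrib_right mult.assoc)
  also have "\<dots> = (\<Sum>a\<in>A. hcoeff f a * hcoeff (g * h) (e - a))"
  proof (rule sum.cong[OF refl])
    fix a assume a: "a \<in> A"
    have "hcoeff (g * h) (e - a) = (\<Sum>c\<in>C. hcoeff g (c - a) * hcoeff h (e - c))"
      by (rule hcoeff_mult_shift[OF finC]) (use CI Af[OF a] in blast)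
    then show "(\<Sum>c\<in>C. hcoeff f a * (hcoeff g (c - a) * hcoeff h (e - c))) =
               hcoeff f a * hcoeff (g * h) (e - a)" by (simp add: sum_distrib_left)
  qed
  also have "\<dots> = hcoeff (f * (g * h)) e"
  proof (rule hcoeff_mult_sum[OF finA, symmetric])
    fix a assume fa: "hcoeff f a \<noteq> 0" and "hcoeff (g * h) (e - a) \<noteq> 0"
    then obtain b where b: "hcoeff g b \<noteq> 0" "hcoeff h (e - a - b) \<noteq> 0"
      by (auto elim: hcoeff_mult_nonzeroD)
    have "a + b \<in> C" using CI[OF fa, of "a + b"] b by (simp add: algebra_simps)
    moreover have "hcoeff g (a + b - a) \<noteq> 0" using b by simp
    ultimately show "a \<in> A" unfolding A_def using fa by blast
  qed
  finally show "hcoeff (f * g * h) e = hcoeff (f * (g * h)) e" .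
qed

lemma hahn_distrib: "(f + g) * h = f * h + g * (h :: hahn)"
proof (rule hahn_eqI)
  fix e
  let ?T = "{a. hcoeff f a \<noteq> 0 \<and> hcoeff h (e - a) \<noteq> 0} \<union> {a. hcoeff g a \<noteq> 0 \<and> hcoeff h (e - a) \<noteq> 0}"
  have fin: "finite ?T" using finite_hfibre by blast
  have "hcoeff ((f + g) * h) e = (\<Sum>a\<in>?T. hcoeff (f + g) a * hcoeff h (e - a))"
    by (rule hcoeff_mult_sum[OF fin]) auto
  moreover have "hcoeff (f * h) e = (\<Sum>a\<in>?T. hcoeff f a * hcoeff h (e - a))"
    by (rule hcoeff_mult_sum[OF fin]) auto
  moreover have "hcoeff (g * h) e = (\<Sum>a\<in>?T. hcoeff g a * hcoeff h (e - a))"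
    by (rule hcoeff_mult_sum[OF fin]) auto
  ultimately show "hcoeff ((f + g) * h) e = hcoeff (f * h + g * h) e"
    by (simp add: sum.distrib distrib_right)
qed

lemma hahn_one_mult: "1 * f = (f :: hahn)"
proof (rule hahn_eqI)
  fix e
  have "hcoeff (1 * f) e = (\<Sum>a\<in>{0}. hcoeff 1 a * hcoeff f (e - a))"
    by (rule hcoeff_mult_sum) (auto simp: hcoeff_1 split: if_splits)
  then show "hcoeff (1 * f) e = hcoeff f e" by (simp add: hcoeff_1)
qed

instance hahn :: comm_ring_1
proof
  fix a b c :: hahn
  show "a * b * c = a * (b * c)" by (rule hahn_mult_assoc)
  show "a * b = b * a" by (rule hahn_mult_comm)
  show "1 * a = a" by (rule hahn_one_mult)
  show "(a + b) * c = a * c + b * c" by (rule hahn_distrib)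
  show "(0 :: hahn) \<noteq> 1"
  proof
    assume "(0 :: hahn) = 1"
    then have "hcoeff 0 0 = hcoeff 1 0" by simp
    then show False by (simp add: hcoeff_1)
  qed
qed (auto intro!: hahn_eqI)

definition hmonom :: "complex \<Rightarrow> real \<Rightarrow> hahn" where
  "hmonom c x = Abs_hahn (\<lambda>e. if e = x then c else 0)"

lemma hcoeff_hmonom: "hcoeff (hmonom c x) e = (if e = x then c else 0)"
  unfolding hmonom_def
  by (subst hcoeff_Abs) (auto intro!: wo_finite rev_finite_subset[of "{x}"] split: if_splits)

lemma hcoeff_hmonom_mult: "hcoeff (hmonom c x * f) e = c * hcoeff f (e - x)"
proof -
  have "hcoeff (hmonom c x * f) e = (\<Sum>a\<in>{x}. hcoeff (hmonom c x) a * hcoeff f (e - a))"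
    by (rule hcoeff_mult_sum) (auto simp: hcoeff_hmonom split: if_splits)
  then show ?thesis by (simp add: hcoeff_hmonom)
qed

lemma hcoeff_power_eq_0:
  assumes "\<And>e. e < s \<Longrightarrow> hcoeff u e = 0" and "e < real k * s"
  shows "hcoeff (u ^ k) e = 0"
  using assms(2)
proof (induction k arbitrary: e)
  case 0
  then show ?case by (simp add: hcoeff_1)
next
  case (Suc k)
  show ?case
  proof (rule ccontr)
    assume "hcoeff (u ^ Suc k) e \<noteq> 0"
    then have "hcoeff (u * u ^ k) e \<noteq> 0" by simp
    then obtain a where a: "hcoeff u a \<noteq> 0" "hcoeff (u ^ k) (e - a) \<noteq> 0"
      by (rule hcoeff_mult_nonzeroD)
    have "s \<le> a" using a(1) assms(1) by (meson not_le)
    moreover have "real k * s \<le> e - a" using a(2) Suc.IH by (meson not_le)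
    ultimately show False using Suc.prems by (simp add: algebra_simps)
  qed
qed

text \<open>Geometric series \<open>1 + u + u\<^sup>2 + \<dots>\<close> for \<open>u\<close> supported on exponents \<open>\<ge> s > 0\<close>.\<close>

lemma hahn_one_minus_invertible:
  assumes s: "s > 0" and u: "\<And>e. e < s \<Longrightarrow> hcoeff u e = 0"
  shows "\<exists>g. (1 - u) * g = 1"
proof -
  define P where "P n = (\<Sum>k<n. u ^ k)" for n
  define N where "N e = Suc (nat \<lfloor>e / s\<rfloor>)" for e
  have N: "e < real (N e) * s" for e
  proof -
    have "e / s < real (N e)" unfolding N_def by linarith
    then show ?thesis using s by (simp add: field_simps)
  qed
  have P_mono: "hcoeff (P n) e = hcoeff (P m) e" if "m \<le> n" "e < real m * s" for m n e
    using that
  proof (induction n rule: dec_induct)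
    case (step n)
    have "e < real n * s"
      using step.prems step.hyps s by (meson less_le_trans mult_right_mono of_nat_mono less_imp_le)
    then show ?case using step hcoeff_power_eq_0[OF u] by (simp add: P_def)
  qed simp
  define g where "g e = hcoeff (P (N e)) e" for e
  have g: "g e = hcoeff (P n) e" if "e < real n * s" for n e
    unfolding g_def using P_mono[of "N e" n e] P_mono[of n "N e" e] that N[of e] by (metis nle_le)
  have "wfp_on {e. g e \<noteq> 0} (<)"
    unfolding wfp_on_real_iff
  proof
    assume "\<exists>x :: nat \<Rightarrow> real. \<forall>i. x i \<in> {e. g e \<noteq> 0} \<and> x (Suc i) < x i"
    then obtain x :: "nat \<Rightarrow> real" where x: "\<And>i. g (x i) \<noteq> 0" "\<And>i. x (Suc i) < x i" by blast
    have "x i \<le> x 0" for i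
      using x(2) by (induction i) (auto intro: order_trans less_imp_le)
    then have "x i < real (N (x 0)) * s" for i using N[of "x 0"] by (meson le_less_trans)
    then have "x i \<in> hsupp (P (N (x 0)))" for i
      using g[of "x i" "N (x 0)"] x(1)[of i] by (simp add: \<open>\<And>i. x i < real (N (x 0)) * s\<close>)
    then show False using wo_hsupp[of "P (N (x 0))"] x(2) unfolding wfp_on_real_iff by blast
  qed
  then have coeff_g: "hcoeff (Abs_hahn g) = g" by (rule hcoeff_Abs)
  have u1: "0 \<le> a" if "hcoeff (1 - u) a \<noteq> 0" for a
    using that u[of a] s by (cases "a < 0") (auto simp: hcoeff_1)
  have "(1 - u) * Abs_hahn g = 1"
  proof (rule hahn_eqI)
    fix e
    let ?n = "N e"
    have eq: "hcoeff (Abs_hahn g) (e - a) = hcoeff (P ?n) (e - a)" if "hcoeff (1 - u) a \<noteq> 0" for a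
      using u1[OF that] N[of e] g[of "e - a" ?n] by (simp add: coeff_g)
    have "hcoeff ((1 - u) * Abs_hahn g) e = hcoeff ((1 - u) * P ?n) e"
      unfolding hcoeff_mult by (rule sum.cong) (use eq in auto)
    also have "(1 - u) * P ?n = 1 - u ^ ?n"
      unfolding P_def by (simp add: one_diff_power_eq)
    also have "hcoeff (1 - u ^ ?n) e = hcoeff 1 e"
      using hcoeff_power_eq_0[OF u N[of e]] by simp
    finally show "hcoeff ((1 - u) * Abs_hahn g) e = hcoeff 1 e" .
  qed
  then show ?thesis by blast
qed

lemma hahn_least_exponent:
  assumes "f \<noteq> 0"
  obtains x where "hcoeff f x \<noteq> 0" "\<And>y. y < x \<Longrightarrow> hcoeff f y = 0"
proof -
  have "hsupp f \<noteq> {}" using assms hahn_eqI[of f 0] by auto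
  then obtain x where "x \<in> hsupp f" "\<forall>y. y < x \<longrightarrow> y \<notin> hsupp f"
    using wo_hsupp[of f] unfolding wfp_on_iff_ex_minimal by (meson order_refl)
  then show ?thesis using that by simp
qed

lemma hahn_invertible:
  assumes "f \<noteq> (0 :: hahn)"
  shows "\<exists>g. f * g = 1"
proof -
  obtain x where x: "hcoeff f x \<noteq> 0" "\<And>y. y < x \<Longrightarrow> hcoeff f y = 0"
    using hahn_least_exponent[OF assms] by blast
  define m where "m = hmonom (inverse (hcoeff f x)) (- x)"
  define u where "u = 1 - m * f"
  have u: "hcoeff u e = (if e = 0 then 1 else 0) - inverse (hcoeff f x) * hcoeff f (e + x)" for e
    by (simp add: u_def m_def hcoeff_hmonom_mult hcoeff_1)
  have u0: "hcoeff u e = 0" if "e \<le> 0" for e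
    using that x by (cases "e = 0") (auto simp: u)
  obtain s where s: "s > 0" "\<And>e. e < s \<Longrightarrow> hcoeff u e = 0"
  proof (cases "u = 0")
    case True
    then show ?thesis using that[of 1] by simp
  next
    case False
    then obtain s where "hcoeff u s \<noteq> 0" "\<And>y. y < s \<Longrightarrow> hcoeff u y = 0"
      using hahn_least_exponent by blast
    then show ?thesis using that[of s] u0 by (meson not_le)
  qed
  obtain g where "(1 - u) * g = 1" using hahn_one_minus_invertible[OF s] by blast
  then have "f * (m * g) = 1" by (simp add: u_def ac_simps)
  then show ?thesis by blast
qed

instantiation hahn :: field
begin

definition inverse_hahn :: "hahn \<Rightarrow> hahn" where
  "inverse_hahn f = (if f = 0 then 0 else (SOME g. f * g = 1))"

definition divide_hahn :: "hahn \<Rightarrow> hahn \<Rightarrow> hahn" where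
  "divide_hahn f g = f * inverse g"

instance
proof
  fix a b :: hahn
  show "inverse a * a = 1" if "a \<noteq> 0"
  proof -
    have "a * inverse a = 1"
      unfolding inverse_hahn_def using that someI_ex[OF hahn_invertible[OF that]] by simp
    then show ?thesis by (simp add: mult.commute)
  qed
  show "a div b = a * inverse b" by (rule divide_hahn_def)
  show "inverse (0 :: hahn) = 0" by (simp add: inverse_hahn_def)
qed

end

definition hdeg :: "hahn \<Rightarrow> ereal" where
  "hdeg f = (if f = 0 then \<infinity> else ereal (LEAST e. hcoeff f e \<noteq> 0))"

lemma hdeg_eq_ereal_iff:
  "hdeg f = ereal x \<longleftrightarrow> hcoeff f x \<noteq> 0 \<and> (\<forall>y<x. hcoeff f y = 0)"
proof (cases "f = 0")
  case True
  then show ?thesis by (simp add: hdeg_def)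
next
  case False
  obtain m where m: "hcoeff f m \<noteq> 0" "\<And>y. y < m \<Longrightarrow> hcoeff f y = 0"
    using hahn_least_exponent[OF False] by blast
  have "(LEAST e. hcoeff f e \<noteq> 0) = m"
    by (rule Least_equality) (use m in \<open>auto simp: not_less[symmetric]\<close>)
  then have "hdeg f = ereal m" using False by (simp add: hdeg_def)
  then show ?thesis using m by (auto) (meson linorder_neqE)
qed


section \<open>Ranks of real matrices and patterns\<close>

definition kapranov_rank :: "real mat \<Rightarrow> nat" where
  "kapranov_rank B = (LEAST r. \<exists>A :: hahn mat. A \<in> carrier_mat (dim_row B) (dim_col B) \<and>
     (\<forall>i<dim_row B. \<forall>j<dim_col B. hdeg (A $$ (i, j)) = ereal (B $$ (i, j))) \<and>
     vec_space.rank (dim_row B) A = r)"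

lemma kapranov_lift_exists:
  "\<exists>A :: hahn mat. A \<in> carrier_mat (dim_row B) (dim_col B) \<and>
     (\<forall>i<dim_row B. \<forall>j<dim_col B. hdeg (A $$ (i, j)) = ereal (B $$ (i, j)))"
  by (rule exI[of _ "mat (dim_row B) (dim_col B) (\<lambda>ij. hmonom 1 (B $$ ij))"])
     (simp add: hdeg_eq_ereal_iff hcoeff_hmonom)

definition trop_nonsingular :: "real mat \<Rightarrow> bool" where
  "trop_nonsingular S \<longleftrightarrow> (\<exists>!\<sigma>. \<sigma> permutes {..<dim_row S} \<and>
     (\<forall>\<tau>. \<tau> permutes {..<dim_row S} \<longrightarrow>
        (\<Sum>i<dim_row S. S $$ (i, \<sigma> i)) \<le> (\<Sum>i<dim_row S. S $$ (i, \<tau> i))))"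

text \<open>The empty submatrix is tropically nonsingular, so the set below always contains \<open>0\<close>.\<close>

definition tropical_rank :: "real mat \<Rightarrow> nat" where
  "tropical_rank A = Max {r. \<exists>I J. I \<subseteq> {..<dim_row A} \<and> J \<subseteq> {..<dim_col A} \<and>
     card I = r \<and> card J = r \<and> trop_nonsingular (submatrix A I J)}"

lemma finite_tropical_rank_set:
  "finite {r. \<exists>I J. I \<subseteq> {..<dim_row A} \<and> J \<subseteq> {..<dim_col A} \<and>
     card I = r \<and> card J = r \<and> trop_nonsingular (submatrix A I J)}"
  by (rule finite_subset[of _ "{..dim_row A}"])
     (auto dest!: card_mono[OF finite_lessThan] simp del: card_mono)

lemma zero_in_tropical_rank_set:
  "0 \<in> {r. \<exists>I J. I \<subseteq> {..<dim_row A} \<and> J \<subseteq> {..<dim_col A} \<and>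
     card I = r \<and> card J = r \<and> trop_nonsingular (submatrix A I J)}"
  by (auto intro!: exI[of _ "{}"] simp: trop_nonsingular_def dim_submatrix)

definition pattern :: "real mat \<Rightarrow> ereal mat" where
  "pattern A = mat (dim_row A) (dim_col A)
     (\<lambda>(u, v). if A $$ (u, v) = Min ((\<lambda>i. A $$ (i, v)) ` {..<dim_row A}) then 0 else \<infinity>)"

lemma pattern_eq_0_iff:
  assumes "u < dim_row A" "v < dim_col A"
  shows "pattern A $$ (u, v) = 0 \<longleftrightarrow> (\<forall>i<dim_row A. A $$ (u, v) \<le> A $$ (i, v))"
proof -
  let ?S = "(\<lambda>i. A $$ (i, v)) ` {..<dim_row A}"
  have "A $$ (u, v) \<in> ?S" "finite ?S" using assms by auto
  then have "A $$ (u, v) = Min ?S \<longleftrightarrow> (\<forall>x\<in>?S. A $$ (u, v) \<le> x)"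
    by (metis Min_eqI Min_le)
  then show ?thesis using assms by (auto simp: pattern_def)
qed

definition column_support :: "ereal mat \<Rightarrow> nat \<Rightarrow> nat set" where
  "column_support P v = {u. u < dim_row P \<and> P $$ (u, v) = 0}"

end

theory Submission
  imports Defs
begin

text \<open>Subtract the minimum from every column. Then the columns fall into three types, according to the
  pair of rows (\<open>{0, 1}\<close>, \<open>{2, 3}\<close> or \<open>{4, 5}\<close>, numbered \<open>0, 1, 2\<close>) where they vanish. We look for a lift whose
  rows satisfy, for each pair \<open>P\<close> with other pairs \<open>Q, R\<close>, a relation
  \<open>x\<^bsub>2P+1\<^esub> = x\<^bsub>2P\<^esub> + 2 t\<^bsup>D\<^esup> x\<^sub>i + 2 t\<^bsup>F\<^esup> x\<^sub>k\<close> with \<open>D, F > 0\<close>, a row \<open>i\<close> of \<open>Q\<close> and a row \<open>k\<close> of \<open>R\<close>; three such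
  relations force the rank to be at most \<open>3\<close>. As the leading coefficients are generic, each column can be
  lifted as soon as its entries are compatible with each relation separately, so the choice of
  \<open>D, F, i, k\<close> decouples over the three pairs. For one pair every column restricts \<open>(D, F)\<close> to a
  tropical line (with its upper part filled in when the two entries of the column agree), and the
  vanishing of tropical \<open>4 \<times> 4\<close> minors yields a common point of these lines.\<close>

section \<open>Common points of tropical lines\<close>

text \<open>Condition for a column with minimum \<open>y\<close> over a pair of rows (\<open>u\<close>: the two entries differ) to
  admit a lift in which the difference of the two rows is a sum of two terms of degrees \<open>p\<close> and \<open>q\<close>:
  the terms either cancel, or their degrees determine that of the difference.\<close>

definition line_ok :: "real \<Rightarrow> real \<Rightarrow> real \<Rightarrow> bool \<Rightarrow> bool" where
  "line_ok p q y u \<longleftrightarrow> (p = q \<and> q < y) \<or> (if u then min p q = y else y \<le> min p q)"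

text \<open>\<open>(D, F)\<close> is a common point, on or above the diagonal, of the tropical lines attached to the columns in
  \<open>A\<close> and \<open>C\<close>. Above the diagonal the line of a column in \<open>A\<close> is vertical.\<close>

definition steep :: "real \<Rightarrow> real \<Rightarrow> ('c \<Rightarrow> real) \<Rightarrow> ('c \<Rightarrow> bool) \<Rightarrow> ('c \<Rightarrow> real) \<Rightarrow> 'c set \<Rightarrow> 'c set \<Rightarrow> bool" where
  "steep D F y u a A C \<longleftrightarrow> 0 < D \<and> D \<le> F \<and> (\<forall>p\<in>A. y p \<le> D \<and> (u p \<longrightarrow> y p = D)) \<and>
     (\<forall>w\<in>C. line_ok (D + a w) F (y w) (u w))"

text \<open>A column \<open>w\<close> has minimum \<open>y w\<close> over the chosen pair, its two entries there differ iff \<open>u w\<close>, and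
  \<open>a w\<close> is its entry in a row of the pair where the columns in \<open>A\<close> vanish. Each of the last three
  assumptions says that the minimum in some tropical \<open>4 \<times> 4\<close> minor is not attained only once.\<close>

locale minors =
  fixes y :: "'c \<Rightarrow> real" and u :: "'c \<Rightarrow> bool" and a :: "'c \<Rightarrow> real" and A C :: "'c set"
  assumes fin: "finite A" "finite C" and ne: "A \<noteq> {}" "C \<noteq> {}"
    and ypos: "\<And>p. p \<in> A \<union> C \<Longrightarrow> 0 < y p" and apos: "\<And>w. w \<in> C \<Longrightarrow> 0 < a w"
    and minor_unb_right: "\<And>w w' p. \<lbrakk>w \<in> C; w' \<in> C; p \<in> A; u w; y w < y w'; y w < a w + y p; y w < a w' + y p\<rbrakk> \<Longrightarrow> False"
    and minor_unb_left: "\<And>w w' p. \<lbrakk>w \<in> C; w' \<in> C; p \<in> A; u p; a w + y p < y w; a w + y p < y w'; a w < a w'\<rbrakk> \<Longrightarrow> False"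
    and minor_triple: "\<And>p q s. \<lbrakk>p \<in> C; q \<in> C; s \<in> C; p \<noteq> q; u q; y q < y s; a p + y q < a q + y p;
        a p + y q < a q + y s; a p + y q < a s + y p; a p < a s;
        a p < y p; a p < y s; a p + y q < y p + y s\<rbrakk> \<Longrightarrow> False"
begin

text \<open>The column \<open>p\<close> forces \<open>D = y p\<close>. It remains to see that the
  least \<open>F\<close> allowed by the inequalities also meets the equalities demanded by the
  columns in \<open>C\<close>.\<close>

lemma steep_of_unbalanced:
  assumes p: "p \<in> A" "u p" and good: "\<And>p'. p' \<in> A \<Longrightarrow> y p' \<le> y p \<and> (u p' \<longrightarrow> y p' = y p)"
    and high: "\<And>w. w \<in> C \<Longrightarrow> u w \<Longrightarrow> \<exists>w'\<in>C. y p \<le> y w'"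
  shows "\<exists>D F. steep D F y u a A C"
proof -
  \<comment> \<open>With \<open>D = y p\<close>, every \<open>w\<close> in \<open>C\<close> demands
    \<open>\<phi> w \<le> F\<close>, and \<open>D \<le> F\<close> adds \<open>y p\<close> to the
    bounds. Equality \<open>F = \<phi> w\<close> is demanded if \<open>y p + a w < y w\<close>, or
    if \<open>u w\<close> and \<open>y w < y p + a w\<close>; the minors exclude a larger bound in
    these cases.\<close>
  define \<phi> where "\<phi> w = min (y w) (y p + a w)" for w
  define F where "F = Max (insert (y p) (\<phi> ` C))"
  have F1: "\<phi> w \<le> F" if "w \<in> C" for w using that fin by (auto simp: F_def)
  have F2: "y p \<le> F" using fin by (auto simp: F_def)
  have "F \<in> insert (y p) (\<phi> ` C)" unfolding F_def by (rule Max_in) (use fin in auto)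
  then have F3: "F = y p \<or> (\<exists>w\<in>C. F = \<phi> w)" by auto
  have "line_ok (y p + a w) F (y w) (u w)" if w: "w \<in> C" for w
  proof (cases "y p + a w < y w")
    case True
    have "F = y p + a w"
    proof (rule ccontr)
      assume "F \<noteq> y p + a w"
      then have "y p + a w < F" using F1[OF w] True by (simp add: \<phi>_def)
      then obtain w' where w': "w' \<in> C" "y p + a w < \<phi> w'" using F3 apos[OF w] by fastforce
      then have "a w + y p < y w'" "a w < a w'" by (simp_all add: \<phi>_def)
      then show False using minor_unb_left[OF w w'(1) p] True by simp
    qed
    then show ?thesis using True by (simp add: line_ok_def)
  next
    case False
    then have yF: "y w \<le> F" using F1[OF w] by (auto simp: \<phi>_def)
    show ?thesis
    proof (cases "u w \<and> y w < y p + a w")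
      case True
      have "F = y w"
      proof (rule ccontr)
        assume "F \<noteq> y w"
        then have less: "y w < F" using yF by simp
        obtain w' where w': "w' \<in> C" "y w < \<phi> w'"
        proof -
          consider "F = y p" | w' where "w' \<in> C" "F = \<phi> w'" using F3 by blast
          then show thesis
          proof cases
            case 1
            \<comment> \<open>The maximum is not attained in \<open>C\<close> a priori;
              \<open>high\<close> supplies a column of \<open>C\<close> whose bound still exceeds
              \<open>y w\<close>, as \<open>a w'\<close> is positive.\<close>
            obtain w' where "w' \<in> C" "y p \<le> y w'" using high w True by blast
            then have "w' \<in> C" "y w < \<phi> w'" using less 1 apos[of w'] by (simp_all add: \<phi>_def)
            then show ?thesis using that by blast
          next
            case 2
            then show ?thesis using that less by simp
          qed
        qed
        then have "y w < y w'" "y w < a w' + y p" by (simp_all add: \<phi>_def)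
        then show False using minor_unb_right[OF w w'(1) p(1)] True by simp
      qed
      then show ?thesis using True False by (simp add: line_ok_def)
    next
      case no: False
      then show ?thesis using False yF by (auto simp: line_ok_def)
    qed
  qed
  moreover have "0 < y p" using ypos p by blast
  ultimately have "steep (y p) F y u a A C" unfolding steep_def using F2 good by blast
  then show ?thesis by blast
qed

text \<open>A balanced column is satisfied as soon as both degrees reach its height, so one large
  value serves as both \<open>D\<close> and \<open>F\<close>.\<close>

lemma steep_of_all_balanced:
  assumes "\<And>p. p \<in> A \<union> C \<Longrightarrow> \<not> u p"
  shows "\<exists>D F. steep D F y u a A C"
proof -
  define M where "M = Max (y ` (A \<union> C))"
  have M: "y p \<le> M" if "p \<in> A \<union> C" for p unfolding M_def by (rule Max_ge) (use that fin in auto)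
  obtain p where "p \<in> A" using ne by auto
  then have "0 < M" using M[of p] ypos[of p] by auto
  moreover have "line_ok (M + a w) M (y w) (u w)" if "w \<in> C" for w
    using that M[of w] apos[of w] assms[of w] by (auto simp: line_ok_def)
  ultimately show ?thesis unfolding steep_def using M assms
    by (intro exI[of _ M]) auto
qed

text \<open>No column in \<open>A\<close> determines \<open>D\<close> here; the lines of the columns \<open>r\<close> and \<open>t\<close> in the proof force its value.\<close>

lemma steep_of_spread:
  assumes bal: "\<And>p. p \<in> A \<Longrightarrow> \<not> u p"
    and r0: "r0 \<in> C" "u r0" and r0min: "\<And>w. w \<in> C \<Longrightarrow> u w \<Longrightarrow> y r0 \<le> y w"
    and t0: "t0 \<in> C" "y r0 < y t0"
  shows "\<exists>D F. steep D F y u a A C"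
proof -
  define g where "g = y r0"
  define R where "R = {w \<in> C. u w \<and> y w = g}"
  define T where "T = {w \<in> C. g < y w}"
  have finRT: "finite R" "finite T" using fin by (auto simp: R_def T_def)
  have R0: "r0 \<in> R" and T0: "t0 \<in> T" using r0 t0 by (auto simp: R_def T_def g_def)
  obtain r where r: "r \<in> R" "\<And>w. w \<in> R \<Longrightarrow> a w \<le> a r"
  proof -
    have "Max (a ` R) \<in> a ` R" by (rule Max_in) (use finRT R0 in auto)
    then obtain r where "r \<in> R" "a r = Max (a ` R)" by auto
    then show thesis using that finRT by auto
  qed
  obtain t where t: "t \<in> T" "\<And>w. w \<in> T \<Longrightarrow> a t \<le> a w"
  proof -
    have "Min (a ` T) \<in> a ` T" by (rule Min_in) (use finRT T0 in auto)
    then obtain t where "t \<in> T" "a t = Min (a ` T)" by auto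
    then show thesis using that finRT by auto
  qed
  have rC: "r \<in> C" "u r" "y r = g" using r by (auto simp: R_def)
  have tC: "t \<in> C" "g < y t" using t by (auto simp: T_def)
  \<comment> \<open>For \<open>D > g - \<rho>\<close> both \<open>D + a r\<close> and
    \<open>D + a t\<close> would exceed \<open>g\<close>: then \<open>r\<close> forces
    \<open>F = g\<close>, whereas \<open>t\<close> demands \<open>F > g\<close>. At
    \<open>D = g - \<rho>\<close> one of the two sums equals \<open>g\<close> and the other is at
    least \<open>g\<close>.\<close>
  define \<rho> where "\<rho> = min (a r) (a t)"
  define D where "D = g - \<rho>"
  have AD: "y p \<le> D" if "p \<in> A" for p
  proof (rule ccontr)
    assume "\<not> y p \<le> D"
    moreover have "\<rho> \<le> a r" "\<rho> \<le> a t" by (simp_all add: \<rho>_def)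
    ultimately have "y r < a r + y p" "y r < a t + y p" using rC by (simp_all add: D_def)
    then show False using minor_unb_right[OF rC(1) tC(1) that rC(2)] rC tC by simp
  qed
  have D0: "0 < D" using AD ne(1) ypos by (metis Un_iff all_not_in_conv less_le_trans)
  define \<phi> where "\<phi> w = min (y w) (D + a w)" for w
  have unb_ge: "g \<le> y w" if "w \<in> C" "u w" for w using that r0min by (simp add: g_def)
  \<comment> \<open>A column of \<open>R\<close> with \<open>g < D + a w\<close> pins
    \<open>F\<close> to \<open>g\<close>, so no column may demand more. As
    \<open>a w \<le> a r\<close>, such a column exists only if \<open>\<rho> = a t\<close>, which
    makes \<open>t\<close> the third column of the minor.\<close>
  have hardR: False if w: "w \<in> R" "g < D + a w" and w': "w' \<in> C" "g < \<phi> w'" for w w'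
  proof -
    have wC: "w \<in> C" "u w" "y w = g" using w by (auto simp: R_def)
    have w'T: "w' \<in> T" "g < D + a w'" using w' by (auto simp: T_def \<phi>_def)
    have "\<rho> < a w" using w by (simp add: D_def)
    then have rt: "\<rho> = a t" using r(2)[OF w(1)] by (simp add: \<rho>_def min_def split: if_splits)
    show False
      by (rule minor_triple[of t w w'])
        (use w'T rt tC wC \<open>\<rho> < a w\<close> w' ypos[of w] D0 in \<open>auto simp: D_def T_def\<close>)
  qed
  have flat: "\<phi> w \<le> g" if "a t < a r" "w \<in> C" for w
  proof (rule ccontr)
    assume "\<not> \<phi> w \<le> g"
    then show False using hardR[of r w] r that by (auto simp: D_def \<rho>_def)
  qed
  \<comment> \<open>\<open>hard1\<close> and \<open>hard2\<close> treat the two kinds of columns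
    that demand \<open>F = \<phi> w\<close>, namely those with \<open>\<phi> w = y w\<close> and
    those with \<open>\<phi> w = D + a w\<close>: no other column demands more.\<close>
  have hard1: False if w: "w \<in> C" "u w" "y w < D + a w" and w': "w' \<in> C" "\<phi> w < \<phi> w'" for w w'
  proof (cases "w \<in> R")
    case True
    then show False using hardR[of w w'] w w' by (auto simp: \<phi>_def R_def)
  next
    case False
    then have wT: "g < y w" "a t \<le> a w" using w unb_ge[of w] t(2)[of w] by (auto simp: R_def T_def)
    have "\<not> a t < a r" using flat[of w] w wT by (auto simp: \<phi>_def)
    then have rr: "\<rho> = a r" by (simp add: \<rho>_def)
    show False
      by (rule minor_triple[of r w w'])
        (use rC w w' wT rr D0 in \<open>auto simp: \<phi>_def D_def\<close>)
  qed
  have hard2: False if w: "w \<in> C" "D + a w < y w" and w': "w' \<in> C" "\<phi> w < \<phi> w'" for w w'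
  proof -
    have *: False if "a w < \<rho>"
      by (rule minor_triple[of w r t])
        (use rC tC w D0 that in \<open>auto simp: D_def \<rho>_def min_def split: if_splits\<close>)
    show False
    proof (cases "a t < a r")
      case True
      have "D + a w < g" using flat[OF True w'(1)] w w' by (auto simp: \<phi>_def)
      then show False using * by (simp add: D_def)
    next
      case False
      then have rr: "\<rho> = a r" by (simp add: \<rho>_def)
      show False
      proof (cases "a w < \<rho>")
        case True
        then show False using * by simp
      next
        case False
        show False
          by (rule minor_triple[of w r w'])
            (use rC w w' False rr D0 in \<open>auto simp: D_def \<phi>_def\<close>)
      qed
    qed
  qed
  define F where "F = Max (insert D (\<phi> ` C))"
  have F1: "\<phi> w \<le> F" if "w \<in> C" for w using that fin by (auto simp: F_def)
  have F2: "D \<le> F" using fin by (auto simp: F_def)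
  have "F \<in> insert D (\<phi> ` C)" unfolding F_def by (rule Max_in) (use fin in auto)
  then have F3: "F = D \<or> (\<exists>w\<in>C. F = \<phi> w)" by auto
  \<comment> \<open>The bound \<open>D\<close> alone is not the maximum, so \<open>F\<close> is
    attained at a column \<open>m\<close> of \<open>C\<close>, against which \<open>hard1\<close>
    and \<open>hard2\<close> can be applied.\<close>
  have "D < \<phi> r" using rC apos[of r] apos[of t] tC D0 by (auto simp: \<phi>_def D_def \<rho>_def)
  then obtain m where m: "m \<in> C" "F = \<phi> m" using F3 F1[of r] rC by auto
  have "line_ok (D + a w) F (y w) (u w)" if w: "w \<in> C" for w
  proof (cases "D + a w < y w")
    case True
    then have "\<phi> w = D + a w" by (simp add: \<phi>_def)
    then have "F = D + a w" using F1[OF w] hard2[of w m] w True m by force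
    then show ?thesis using True by (simp add: line_ok_def)
  next
    case False
    then have \<phi>: "\<phi> w = y w" by (simp add: \<phi>_def)
    show ?thesis
    proof (cases "u w \<and> y w < D + a w")
      case True
      then have "F = y w" using F1[OF w] hard1[of w m] w m \<phi> by force
      then show ?thesis using True by (simp add: line_ok_def)
    next
      case no: False
      then show ?thesis using False F1[OF w] \<phi> by (auto simp: line_ok_def)
    qed
  qed
  then show ?thesis
    unfolding steep_def using F2 D0 AD bal by (intro exI[of _ D] exI[of _ F]) auto
qed

end

section \<open>Tropically singular minors\<close>

text \<open>Rows and columns are lists in arbitrary order, so that a unique optimal permutation of a
  minor can always be arranged to be the diagonal.\<close>

definition strict_diagonal :: "(nat \<Rightarrow> 'c \<Rightarrow> real) \<Rightarrow> nat list \<Rightarrow> 'c list \<Rightarrow> bool" where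
  "strict_diagonal W rs cs \<longleftrightarrow> (\<forall>\<tau>. \<tau> permutes {..<length rs} \<longrightarrow> \<tau> \<noteq> id \<longrightarrow>
     (\<Sum>i<length rs. W (rs ! i) (cs ! i)) < (\<Sum>i<length rs. W (rs ! i) (cs ! \<tau> i)))"

text \<open>Reduces unique optimality of the diagonal to the other 23 permutations, which
  \<open>quadruples\<close> enumerates for linear arithmetic.\<close>

lemma strict_diagonal_4:
  fixes W :: "nat \<Rightarrow> 'c \<Rightarrow> real"
  assumes "\<And>a b c d. \<lbrakk>{a, b, c, d} = {0, 1, 2, 3 :: nat}; (a, b, c, d) \<noteq> (0, 1, 2, 3)\<rbrakk> \<Longrightarrow>
    W r0 c0 + W r1 c1 + W r2 c2 + W r3 c3 <
    W r0 ([c0, c1, c2, c3] ! a) + W r1 ([c0, c1, c2, c3] ! b) + W r2 ([c0, c1, c2, c3] ! c) + W r3 ([c0, c1, c2, c3] ! d)"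
  shows "strict_diagonal W [r0, r1, r2, r3] [c0, c1, c2, c3]"
  unfolding strict_diagonal_def
proof (intro allI impI)
  fix \<tau> :: "nat \<Rightarrow> nat" assume \<tau>: "\<tau> permutes {..<length [r0, r1, r2, r3]}" "\<tau> \<noteq> id"
  have dom: "{..<length [r0, r1, r2, r3]} = {0, 1, 2, 3}"
    by (auto simp: less_Suc_eq numeral_eq_Suc)
  have perm: "{\<tau> 0, \<tau> 1, \<tau> 2, \<tau> 3} = {0, 1, 2, 3}"
    using permutes_image[OF \<tau>(1)] unfolding dom image_insert image_empty .
  have "(\<tau> 0, \<tau> 1, \<tau> 2, \<tau> 3) \<noteq> (0, 1, 2, 3)"
  proof
    assume "(\<tau> 0, \<tau> 1, \<tau> 2, \<tau> 3) = (0, 1, 2, 3)"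
    then have *: "\<tau> 0 = 0" "\<tau> 1 = 1" "\<tau> 2 = 2" "\<tau> 3 = 3" by blast+
    have "\<tau> x = x" for x
    proof (cases "x \<in> {0, 1, 2, 3}")
      case True
      then show ?thesis using * by blast
    next
      case False
      then show ?thesis using permutes_not_in[OF \<tau>(1)] unfolding dom by blast
    qed
    then show False using \<tau>(2) by (simp add: fun_eq_iff)
  qed
  from assms[OF perm this]
  show "(\<Sum>i<length [r0, r1, r2, r3]. W ([r0, r1, r2, r3] ! i) ([c0, c1, c2, c3] ! i))
      < (\<Sum>i<length [r0, r1, r2, r3]. W ([r0, r1, r2, r3] ! i) ([c0, c1, c2, c3] ! \<tau> i))"
    by (simp add: lessThan_Suc numeral_eq_Suc add_ac)
qed

lemma quadruples:
  assumes "{a, b, c, d} = {0, 1, 2, 3 :: nat}"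
  shows "(a, b, c, d) \<in> {(0,1,2,3),(0,1,3,2),(0,2,1,3),(0,2,3,1),(0,3,1,2),(0,3,2,1),
    (1,0,2,3),(1,0,3,2),(1,2,0,3),(1,2,3,0),(1,3,0,2),(1,3,2,0),
    (2,0,1,3),(2,0,3,1),(2,1,0,3),(2,1,3,0),(2,3,0,1),(2,3,1,0),
    (3,0,1,2),(3,0,2,1),(3,1,0,2),(3,1,2,0),(3,2,0,1),(3,2,1,0)}"
proof -
  have r: "a \<in> {0, 1, 2, 3}" "b \<in> {0, 1, 2, 3}" "c \<in> {0, 1, 2, 3}" "d \<in> {0, 1, 2, 3}"
    using assms by blast+
  have "card {a, b, c, d} = 4" using assms by simp
  then have "distinct [a, b, c, d]" by (intro card_distinct) simp
  then show ?thesis using r by (elim insertE emptyE; simp)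
qed

text \<open>\<open>W\<close> is the matrix after subtracting column minima, and \<open>col P\<close>
  holds the columns vanishing exactly on the row pair \<open>P\<close>. The assumption
  \<open>sing\<close> is what tropical rank at most 3 gives for \<open>4 x 4\<close> minors.\<close>

locale pair_columns =
  fixes W :: "nat \<Rightarrow> 'c \<Rightarrow> real" and col :: "nat \<Rightarrow> 'c set"
  assumes fin: "\<And>P. P < 3 \<Longrightarrow> finite (col P)" and ne: "\<And>P. P < 3 \<Longrightarrow> col P \<noteq> {}"
    and zero: "\<And>P r w. \<lbrakk>P < 3; w \<in> col P; r div 2 = P\<rbrakk> \<Longrightarrow> W r w = 0"
    and pos: "\<And>P Q r w. \<lbrakk>P < 3; Q < 3; Q \<noteq> P; w \<in> col P; r div 2 = Q\<rbrakk> \<Longrightarrow> 0 < W r w"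
    and sing: "\<And>rs cs. \<lbrakk>length rs = 4; length cs = 4; distinct rs; distinct cs; set rs \<subseteq> {..<6};
        set cs \<subseteq> col 0 \<union> col 1 \<union> col 2; strict_diagonal W rs cs\<rbrakk> \<Longrightarrow> False"
begin

definition low :: "nat \<Rightarrow> 'c \<Rightarrow> real" where
  "low P w = min (W (2 * P) w) (W (2 * P + 1) w)"

definition unb :: "nat \<Rightarrow> 'c \<Rightarrow> bool" where
  "unb P w \<longleftrightarrow> W (2 * P) w \<noteq> W (2 * P + 1) w"

lemma col_Un: "P < 3 \<Longrightarrow> w \<in> col P \<Longrightarrow> w \<in> col 0 \<union> col 1 \<union> col 2"
  by (auto simp: less_Suc_eq numeral_3_eq_3 numeral_2_eq_2)

lemma col_disjoint: "\<lbrakk>P < 3; Q < 3; P \<noteq> Q; w \<in> col P\<rbrakk> \<Longrightarrow> w \<notin> col Q"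
  using zero[of P w "2 * P"] pos[of Q P w "2 * P"] by fastforce

lemma low_pos: "\<lbrakk>P < 3; Q < 3; P \<noteq> Q; w \<in> col Q\<rbrakk> \<Longrightarrow> 0 < low P w"
  using pos[of Q P w "2 * P"] pos[of Q P w "2 * P + 1"] by (simp add: low_def)

lemma unb_rows:
  assumes "unb P w"
  obtains j j' where "j div 2 = P" "j' div 2 = P" "j \<noteq> j'" "low P w = W j w" "W j w < W j' w"
    "\<And>v. low P v = min (W j v) (W j' v)"
proof (cases "W (2 * P) w < W (2 * P + 1) w")
  case True
  show ?thesis by (rule that[of "2 * P" "2 * P + 1"]) (use True in \<open>auto simp: low_def\<close>)
next
  case False
  show ?thesis
    by (rule that[of "2 * P + 1" "2 * P"]) (use False assms in \<open>auto simp: low_def unb_def\<close>)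
qed

lemma no_strict:
  assumes "distinct [r0, r1, r2, r3]" "{r0, r1, r2, r3} \<subseteq> {..<6}" "distinct [c0, c1, c2, c3]"
    "{c0, c1, c2, c3} \<subseteq> col 0 \<union> col 1 \<union> col 2"
    "strict_diagonal W [r0, r1, r2, r3] [c0, c1, c2, c3]"
  shows False
  using sing[of "[r0, r1, r2, r3]" "[c0, c1, c2, c3]"] assms by simp

section \<open>Tropical \<open>4 x 4\<close> minors built from the three types of columns\<close>

context
  fixes P Q R i :: nat
  assumes PQR: "P < 3" "Q < 3" "R < 3" "P \<noteq> Q" "P \<noteq> R" "Q \<noteq> R" and i: "i div 2 = Q"
begin

lemmas zerosX = zero[OF PQR(1)] zero[OF PQR(2)] zero[OF PQR(3)]

lemmas posX = pos[OF PQR(1,2) PQR(4)[symmetric]] pos[OF PQR(1,3) PQR(5)[symmetric]]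
  pos[OF PQR(2,1) PQR(4)] pos[OF PQR(2,3) PQR(6)[symmetric]] pos[OF PQR(3,1) PQR(5)] pos[OF PQR(3,2) PQR(6)]

lemmas disjointX = col_disjoint[OF PQR(1,2,4)] col_disjoint[OF PQR(1,3,5)] col_disjoint[OF PQR(2,3,6)]

lemma row_bound: "r div 2 \<in> {P, Q, R} \<Longrightarrow> r < 6" using PQR by auto

text \<open>The diagonal of the minor with rows \<open>i, j, j', k\<close> and columns
  \<open>p, w, v, w'\<close> costs only \<open>low P w\<close>. The column \<open>v\<close> vanishes
  in both rows of \<open>P\<close>, so \<open>w\<close> can take its smaller row \<open>j\<close>;
  as \<open>w\<close> is unbalanced on \<open>P\<close>, exchanging \<open>v\<close> and
  \<open>w\<close> is strictly worse.\<close>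

lemma minor_two_unbalanced_left:
  assumes w: "w \<in> col R" "w' \<in> col R" and p: "p \<in> col Q" and u: "unb P w"
    and less: "low P w < low P w'" "low P w < W i w + low P p" "low P w < W i w' + low P p"
  shows False
proof -
  obtain j j' where j: "j div 2 = P" "j' div 2 = P" "j \<noteq> j'" "low P w = W j w" "W j w < W j' w"
    "\<And>v. low P v = min (W j v) (W j' v)" using unb_rows[OF u] by blast
  obtain v where v: "v \<in> col P" using ne[OF PQR(1)] by blast
  define k where "k = 2 * R"
  have k: "k div 2 = R" by (simp add: k_def)
  have z: "W k w = 0" "W k w' = 0" "W i p = 0" "W j v = 0" "W j' v = 0"
    using zerosX k w p v i j by simp_all
  have ps: "0 < W i w" "0 < W i w'" "0 < W i v" "0 < W k p" "0 < W k v" "0 < W j w" "0 < W j w'"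
      "0 < W j p" "0 < W j' w" "0 < W j' w'" "0 < W j' p"
    using posX k w p v i j by simp_all
  have low: "low P x \<le> W j x" "low P x \<le> W j' x" for x using j(6)[of x] by simp_all
  show False
  proof (rule no_strict[of i j j' k p w v w'])
    show "distinct [i, j, j', k]" using i j k PQR by auto
    show "{i, j, j', k} \<subseteq> {..<6}" using row_bound i j k by simp
    show "distinct [p, w, v, w']" using disjointX w p v less(1) by auto
    show "{p, w, v, w'} \<subseteq> col 0 \<union> col 1 \<union> col 2" using col_Un PQR w p v by blast
    show "strict_diagonal W [i, j, j', k] [p, w, v, w']"
    proof (rule strict_diagonal_4, goal_cases)
      case (1 a b c d)
      have "(a, b, c, d) \<noteq> (0, 1, 2, 3)" by (rule 1(2))
      with quadruples[OF 1(1)] show ?case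
        by (elim insertE emptyE; clarsimp simp: z simp flip: One_nat_def)
          (use low[of p] low[of w'] low[of w] ps less j(4,5) in linarith)+
    qed
  qed
qed

text \<open>Same rows as before, with columns \<open>w, p, v, w'\<close>; the diagonal costs
  \<open>W i w + low P p\<close>, and now \<open>p\<close> is the column unbalanced on
  \<open>P\<close>.\<close>

lemma minor_two_unbalanced_right:
  assumes w: "w \<in> col R" "w' \<in> col R" and p: "p \<in> col Q" and u: "unb P p"
    and less: "W i w + low P p < low P w" "W i w + low P p < low P w'" "W i w < W i w'"
  shows False
proof -
  obtain j j' where j: "j div 2 = P" "j' div 2 = P" "j \<noteq> j'" "low P p = W j p" "W j p < W j' p"
    "\<And>v. low P v = min (W j v) (W j' v)" using unb_rows[OF u] by blast
  obtain v where v: "v \<in> col P" using ne[OF PQR(1)] by blast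
  define k where "k = 2 * R"
  have k: "k div 2 = R" by (simp add: k_def)
  have z: "W k w = 0" "W k w' = 0" "W i p = 0" "W j v = 0" "W j' v = 0"
    using zerosX k w p v i j by simp_all
  have ps: "0 < W i w" "0 < W i w'" "0 < W i v" "0 < W k p" "0 < W k v" "0 < W j w" "0 < W j w'"
      "0 < W j p" "0 < W j' w" "0 < W j' w'" "0 < W j' p"
    using posX k w p v i j by simp_all
  have low: "low P x \<le> W j x" "low P x \<le> W j' x" for x using j(6)[of x] by simp_all
  show False
  proof (rule no_strict[of i j j' k w p v w'])
    show "distinct [i, j, j', k]" using i j k PQR by auto
    show "{i, j, j', k} \<subseteq> {..<6}" using row_bound i j k by simp
    show "distinct [w, p, v, w']" using disjointX w p v less(3) by auto
    show "{w, p, v, w'} \<subseteq> col 0 \<union> col 1 \<union> col 2" using col_Un PQR w p v by blast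
    show "strict_diagonal W [i, j, j', k] [w, p, v, w']"
    proof (rule strict_diagonal_4, goal_cases)
      case (1 a b c d)
      have "(a, b, c, d) \<noteq> (0, 1, 2, 3)" by (rule 1(2))
      with quadruples[OF 1(1)] show ?case
        by (elim insertE emptyE; clarsimp simp: z simp flip: One_nat_def)
          (use low[of p] low[of w'] low[of w] ps less j(4,5) in linarith)+
    qed
  qed
qed

text \<open>Here three columns come from \<open>R\<close> and none from \<open>Q\<close>: with
  columns \<open>p, q, v, s\<close> the diagonal costs \<open>W i p + low P q\<close>.\<close>

lemma minor_three_right:
  assumes w: "p \<in> col R" "q \<in> col R" "s \<in> col R" and u: "unb P q" and pq: "p \<noteq> q"
    and less: "low P q < low P s" "W i p + low P q < W i q + low P p"
      "W i p + low P q < W i q + low P s" "W i p + low P q < W i s + low P p" "W i p < W i s"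
      "W i p < low P p" "W i p < low P s" "W i p + low P q < low P p + low P s"
  shows False
proof -
  obtain j j' where j: "j div 2 = P" "j' div 2 = P" "j \<noteq> j'" "low P q = W j q" "W j q < W j' q"
    "\<And>v. low P v = min (W j v) (W j' v)" using unb_rows[OF u] by blast
  obtain v where v: "v \<in> col P" using ne[OF PQR(1)] by blast
  define k where "k = 2 * R"
  have k: "k div 2 = R" by (simp add: k_def)
  have z: "W k p = 0" "W k q = 0" "W k s = 0" "W j v = 0" "W j' v = 0"
    using zerosX k w v i j by simp_all
  have ps: "0 < W i p" "0 < W i q" "0 < W i s" "0 < W i v" "0 < W k v" "0 < W j p" "0 < W j q"
      "0 < W j s" "0 < W j' p" "0 < W j' q" "0 < W j' s"
    using posX k w v i j by simp_all
  have low: "low P x \<le> W j x" "low P x \<le> W j' x" for x using j(6)[of x] by simp_all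
  show False
  proof (rule no_strict[of i j j' k p q v s])
    show "distinct [i, j, j', k]" using i j k PQR by auto
    show "{i, j, j', k} \<subseteq> {..<6}" using row_bound i j k by simp
    show "distinct [p, q, v, s]" using disjointX w v less(1,5) pq by auto
    show "{p, q, v, s} \<subseteq> col 0 \<union> col 1 \<union> col 2" using col_Un PQR w v by blast
    show "strict_diagonal W [i, j, j', k] [p, q, v, s]"
    proof (rule strict_diagonal_4, goal_cases)
      case (1 a b c d)
      have "(a, b, c, d) \<noteq> (0, 1, 2, 3)" by (rule 1(2))
      with quadruples[OF 1(1)] show ?case
        by (elim insertE emptyE; clarsimp simp: z simp flip: One_nat_def)
          (use low[of p] low[of q] low[of s] ps less j(4,5) in linarith)+
    qed
  qed
qed

lemma minors: "minors (low P) (unb P) (W i) (col Q) (col R)"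
proof
  show "finite (col Q)" "finite (col R)" "col Q \<noteq> {}" "col R \<noteq> {}" using fin ne PQR by auto
  show "0 < low P p" if "p \<in> col Q \<union> col R" for p using that low_pos PQR by auto
  show "0 < W i w" if "w \<in> col R" for w using that posX i by simp
qed (use minor_two_unbalanced_left minor_two_unbalanced_right minor_three_right in blast)+

end

end

section \<open>Choice of the relations\<close>

text \<open>Row \<open>k\<close> of the pair \<open>R\<close> carries the term of degree \<open>F\<close> in the relation for the pair \<open>P\<close>. If the
  two terms of that relation cancel, the cancellation fixes the leading coefficient in row \<open>k\<close>, so
  the other row of \<open>R\<close> must not be the larger one.\<close>

definition fits_at :: "(nat \<Rightarrow> real) \<Rightarrow> nat \<Rightarrow> nat \<Rightarrow> real \<Rightarrow> real \<Rightarrow> nat \<Rightarrow> bool" where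
  "fits_at w P R D F k \<longleftrightarrow>
     line_ok D (F + w k) (min (w (2 * P)) (w (2 * P + 1))) (w (2 * P) \<noteq> w (2 * P + 1)) \<and>
     (D = F + w k \<longrightarrow> D < min (w (2 * P)) (w (2 * P + 1)) \<longrightarrow> (\<forall>r. r div 2 = R \<longrightarrow> w r \<le> w k))"

definition pair_fits :: "(nat \<Rightarrow> 'c \<Rightarrow> real) \<Rightarrow> (nat \<Rightarrow> 'c set) \<Rightarrow> nat \<Rightarrow> nat \<Rightarrow> nat \<Rightarrow> real \<Rightarrow> real \<Rightarrow> nat \<Rightarrow> bool" where
  "pair_fits W cs P Q R D F k \<longleftrightarrow> (\<forall>v\<in>cs Q. fits_at (\<lambda>r. W r v) P R D F k)"

lemma ex_min_on:
  fixes f :: "'a \<Rightarrow> real"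
  assumes "finite S" "x \<in> S" "p x"
  obtains m where "m \<in> S" "p m" "\<And>s. s \<in> S \<Longrightarrow> p s \<Longrightarrow> f m \<le> f s"
proof -
  have "Min (f ` {s \<in> S. p s}) \<in> f ` {s \<in> S. p s}"
    by (rule Min_in) (use assms in auto)
  then obtain m where "m \<in> S" "p m" "f m = Min (f ` {s \<in> S. p s})" by auto
  then show thesis using that assms(1) by auto
qed

section \<open>Existence of a common point for each pair of rows\<close>

context pair_columns
begin

abbreviation steep_at :: "nat \<Rightarrow> nat \<Rightarrow> nat \<Rightarrow> nat \<Rightarrow> bool" where
  "steep_at P Q R i \<equiv> \<exists>D F. steep D F (low P) (unb P) (W i) (col Q) (col R)"

text \<open>The second alternative is the failure of the hypothesis \<open>high\<close> of
  \<open>steep_of_unbalanced\<close>. It does not mention the row \<open>i\<close>, so the first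
  alternative covers both rows of \<open>Q\<close> at once.\<close>

lemma steep_at_or_higher:
  assumes PQR: "P < 3" "Q < 3" "R < 3" "P \<noteq> Q" "P \<noteq> R" "Q \<noteq> R"
    and p: "p \<in> col Q" "unb P p" and max: "\<And>p'. p' \<in> col Q \<Longrightarrow> low P p' \<le> low P p"
    and min: "\<And>p'. p' \<in> col Q \<Longrightarrow> unb P p' \<Longrightarrow> low P p \<le> low P p'"
  shows "(\<forall>i. i div 2 = Q \<longrightarrow> steep_at P Q R i) \<or>
    ((\<exists>w\<in>col R. unb P w) \<and> (\<forall>w\<in>col R. low P w < low P p))"
proof (rule disjCI)
  assume a: "\<not> ((\<exists>w\<in>col R. unb P w) \<and> (\<forall>w\<in>col R. low P w < low P p))"
  show "\<forall>i. i div 2 = Q \<longrightarrow> steep_at P Q R i"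
  proof (intro allI impI)
    fix i assume i: "i div 2 = Q"
    interpret minors "low P" "unb P" "W i" "col Q" "col R" by (rule minors[OF PQR i])
    show "steep_at P Q R i"
    proof (rule steep_of_unbalanced[OF p])
      show "low P p' \<le> low P p \<and> (unb P p' \<longrightarrow> low P p' = low P p)" if "p' \<in> col Q" for p'
        using max[OF that] min[OF that] by linarith
      show "\<exists>w'\<in>col R. low P p \<le> low P w'" if "w \<in> col R" "unb P w" for w
        using a that by (meson not_le)
    qed
  qed
qed

text \<open>Take the lowest unbalanced column of \<open>R\<close>. If some column of
  \<open>R\<close> is higher, \<open>steep_of_spread\<close> applies; otherwise all unbalanced
  columns of \<open>R\<close> share the top height, and exchanging \<open>Q\<close> and
  \<open>R\<close> makes that column the one that fixes the vertical line.\<close>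

lemma steep_if_one_side:
  assumes PQR: "P < 3" "Q < 3" "R < 3" "P \<noteq> Q" "P \<noteq> R" "Q \<noteq> R"
    and bal: "\<And>p. p \<in> col Q \<Longrightarrow> \<not> unb P p" and w: "w \<in> col R" "unb P w"
  shows "(\<forall>i. i div 2 = Q \<longrightarrow> steep_at P Q R i) \<or> (\<forall>k. k div 2 = R \<longrightarrow> steep_at P R Q k)"
proof -
  obtain r where r: "r \<in> col R" "unb P r" "\<And>w. w \<in> col R \<Longrightarrow> unb P w \<Longrightarrow> low P r \<le> low P w"
    using ex_min_on[OF fin[OF PQR(3)] w(1), of "unb P" "low P"] w(2) by blast
  show ?thesis
  proof (cases "\<exists>t\<in>col R. low P r < low P t")
    case True
    then obtain t where t: "t \<in> col R" "low P r < low P t" by blast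
    have "steep_at P Q R i" if "i div 2 = Q" for i
      using minors.steep_of_spread[OF minors[OF PQR that] bal r t] by blast
    then show ?thesis by blast
  next
    case False
    then have top: "\<And>p'. p' \<in> col R \<Longrightarrow> low P p' \<le> low P r" by (meson not_le)
    show ?thesis
      using steep_at_or_higher[OF PQR(1,3,2,5,4) PQR(6)[symmetric] r(1,2) top r(3)] bal by blast
  qed
qed

text \<open>If both sides have unbalanced columns, compare the lowest one of each. By a minor, the
  lower of the two has maximal height on its own side, so it can fix the vertical line
  there.\<close>

lemma steep_either:
  assumes PQR: "P < 3" "Q < 3" "R < 3" "P \<noteq> Q" "P \<noteq> R" "Q \<noteq> R"
  shows "(\<forall>i. i div 2 = Q \<longrightarrow> steep_at P Q R i) \<or> (\<forall>k. k div 2 = R \<longrightarrow> steep_at P R Q k)"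
proof -
  have PRQ: "P < 3" "R < 3" "Q < 3" "P \<noteq> R" "P \<noteq> Q" "R \<noteq> Q" using PQR by auto
  consider "\<And>p. p \<in> col Q \<union> col R \<Longrightarrow> \<not> unb P p"
    | w where "\<And>p. p \<in> col Q \<Longrightarrow> \<not> unb P p" "w \<in> col R" "unb P w"
    | p where "\<And>w. w \<in> col R \<Longrightarrow> \<not> unb P w" "p \<in> col Q" "unb P p"
    | p w where "p \<in> col Q" "unb P p" "w \<in> col R" "unb P w" by blast
  then show ?thesis
  proof cases
    case 1
    then show ?thesis using minors.steep_of_all_balanced[OF minors[OF PQR]] by blast
  next
    case 2
    then show ?thesis using steep_if_one_side[OF PQR] by blast
  next
    case 3
    then show ?thesis using steep_if_one_side[OF PRQ] by blast
  next
    case 4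
    obtain p0 where p0: "p0 \<in> col Q" "unb P p0" "\<And>w. w \<in> col Q \<Longrightarrow> unb P w \<Longrightarrow> low P p0 \<le> low P w"
      using ex_min_on[OF fin[OF PQR(2)] 4(1), of "unb P" "low P"] 4(2) by blast
    obtain r0 where r0: "r0 \<in> col R" "unb P r0" "\<And>w. w \<in> col R \<Longrightarrow> unb P w \<Longrightarrow> low P r0 \<le> low P w"
      using ex_min_on[OF fin[OF PQR(3)] 4(3), of "unb P" "low P"] 4(4) by blast
    have posr: "0 < W (2 * Q) w" if "w \<in> col R" for w using pos[OF PQR(3,2,6)] that by simp
    have posp: "0 < W (2 * R) w" if "w \<in> col Q" for w using pos[OF PRQ(3,2,6)] that by simp
    have rtop: "low P t \<le> low P r0" if "t \<in> col R" "s \<in> col Q" "low P r0 \<le> low P s" for s t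
    proof (rule ccontr)
      assume "\<not> low P t \<le> low P r0"
      then show False
        using minor_two_unbalanced_left[OF PQR, of "2 * Q" r0 t s] that r0(1,2) posr[of r0] posr[of t]
        by simp
    qed
    have ptop: "low P t \<le> low P p0" if "t \<in> col Q" "s \<in> col R" "low P p0 \<le> low P s" for s t
    proof (rule ccontr)
      assume "\<not> low P t \<le> low P p0"
      then show False
        using minor_two_unbalanced_left[OF PRQ, of "2 * R" p0 t s] that p0(1,2) posp[of p0] posp[of t]
        by simp
    qed
    show ?thesis
    proof (cases "low P r0 \<le> low P p0")
      case True
      have top: "\<And>t. t \<in> col R \<Longrightarrow> low P t \<le> low P r0" using rtop p0(1) True by blast
      have "\<not> (\<forall>w\<in>col Q. low P w < low P r0)" using p0(1) True by (meson not_le)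
      then show ?thesis using steep_at_or_higher[OF PRQ r0(1,2) top r0(3)] by blast
    next
      case False
      then have le: "low P p0 \<le> low P r0" by simp
      have top: "\<And>t. t \<in> col Q \<Longrightarrow> low P t \<le> low P p0" using ptop r0(1) le by blast
      have "\<not> (\<forall>w\<in>col R. low P w < low P p0)" using r0(1) le by (meson not_le)
      then show ?thesis using steep_at_or_higher[OF PQR p0(1,2) top p0(3)] by blast
    qed
  qed
qed

text \<open>If neither row \<open>i\<close> of pair \<open>Q\<close> could serve, the two offending columns would be unbalanced on
  \<open>Q\<close> at different heights, against the minor condition for the pair \<open>Q\<close>.\<close>

lemma ex_base_row:
  assumes PQR: "P < 3" "Q < 3" "R < 3" "P \<noteq> Q" "P \<noteq> R" "Q \<noteq> R"
    and st: "\<And>i. i div 2 = Q \<Longrightarrow> steep_at P Q R i"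
  shows "\<exists>D F i. i div 2 = Q \<and> steep D F (low P) (unb P) (W i) (col Q) (col R) \<and>
    (\<forall>w\<in>col R. D + W i w = F \<longrightarrow> F < low P w \<longrightarrow> (\<forall>i'. i' div 2 = Q \<longrightarrow> W i' w \<le> W i w))"
proof (rule ccontr)
  assume neg: "\<not> ?thesis"
  have QPR: "Q < 3" "P < 3" "R < 3" "Q \<noteq> P" "Q \<noteq> R" "P \<noteq> R" using PQR by auto
  have bad: "\<exists>w\<in>col R. D + W i w = F \<and> F < low P w \<and> W i w < W i' w"
    if "steep D F (low P) (unb P) (W i) (col Q) (col R)" "{i, i'} = {2 * Q, 2 * Q + 1}" for D F i i'
  proof -
    have *: "i div 2 = Q" "\<And>r. r div 2 = Q \<Longrightarrow> r = i \<or> r = i'"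
      using that(2) by (auto simp: doubleton_eq_iff)
    have "\<not> (\<forall>w\<in>col R. D + W i w = F \<longrightarrow> F < low P w \<longrightarrow> (\<forall>i'. i' div 2 = Q \<longrightarrow> W i' w \<le> W i w))"
      using neg that(1) *(1) by blast
    then obtain w r where "w \<in> col R" "D + W i w = F" "F < low P w" "r div 2 = Q" "W i w < W r w"
      by (meson not_le)
    then show ?thesis using * by (metis less_irrefl)
  qed
  obtain D1 F1 where s1: "steep D1 F1 (low P) (unb P) (W (2 * Q)) (col Q) (col R)"
    using st[of "2 * Q"] by auto
  obtain D2 F2 where s2: "steep D2 F2 (low P) (unb P) (W (2 * Q + 1)) (col Q) (col R)"
    using st[of "2 * Q + 1"] by auto
  obtain w1 where w1: "w1 \<in> col R" "D1 + W (2 * Q) w1 = F1" "F1 < low P w1" "W (2 * Q) w1 < W (2 * Q + 1) w1"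
    using bad[OF s1, of "2 * Q + 1"] by blast
  obtain w2 where w2: "w2 \<in> col R" "D2 + W (2 * Q + 1) w2 = F2" "F2 < low P w2" "W (2 * Q + 1) w2 < W (2 * Q) w2"
    using bad[OF s2, of "2 * Q"] by blast
  have D: "0 < D1" "0 < D2" "D1 \<le> F1" "D2 \<le> F2" using s1 s2 by (auto simp: steep_def)
  have l1: "line_ok (D1 + W (2 * Q) w2) F1 (low P w2) (unb P w2)" using s1 w2 by (auto simp: steep_def)
  have l2: "line_ok (D2 + W (2 * Q + 1) w1) F2 (low P w1) (unb P w1)" using s2 w1 by (auto simp: steep_def)
  obtain v where v: "v \<in> col P" using ne[OF PQR(1)] by blast
  have lv: "0 < low Q v" using low_pos[OF QPR(1,2,4)] v by blast
  have lw: "low P w \<le> W (2 * P) w" for w by (simp add: low_def)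
  have u12: "unb Q w1" "unb Q w2" using w1(4) w2(4) by (auto simp: unb_def)
  have q1: "low Q w1 = W (2 * Q) w1" "low Q w2 = W (2 * Q + 1) w2" using w1(4) w2(4) by (auto simp: low_def)
  \<comment> \<open>From \<open>F1 < low P w1\<close> and \<open>F2 < low P w2\<close>, one of the
    two points also lies below the height of the other offending column. Below the height only
    cancellation satisfies \<open>line_ok\<close>, and this gives \<open>w1\<close> and
    \<open>w2\<close> equal entries in one row of \<open>Q\<close>.\<close>
  show False
  proof (cases "F2 < low P w1")
    case True
    then have "D2 + W (2 * Q + 1) w1 = F2" using l2 by (auto simp: line_ok_def split: if_splits)
    then have "W (2 * Q + 1) w1 = W (2 * Q + 1) w2" using w2 by simp
    then show False
      using minor_two_unbalanced_left[OF QPR, of "2 * P" w1 w2 v] w1 w2 v u12 q1 lv lw[of w1] lw[of w2] D by simp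
  next
    case False
    then have "F1 < low P w2" using w1 w2 by simp
    then have "D1 + W (2 * Q) w2 = F1" using l1 by (auto simp: line_ok_def split: if_splits)
    then have "W (2 * Q) w1 = W (2 * Q) w2" using w1 by simp
    then show False
      using minor_two_unbalanced_left[OF QPR, of "2 * P" w2 w1 v] w1 w2 v u12 q1 lv lw[of w1] lw[of w2] D by simp
  qed
qed

lemma steep_pair_fits:
  assumes PQR: "P < 3" "Q < 3" "R < 3" "P \<noteq> Q" "P \<noteq> R" "Q \<noteq> R"
    and st: "\<And>i. i div 2 = Q \<Longrightarrow> steep_at P Q R i"
  shows "\<exists>D F i k. 0 < D \<and> 0 < F \<and> i div 2 = Q \<and> k div 2 = R \<and>
    pair_fits W col P Q R D F k \<and> pair_fits W col P R Q F D i"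
proof -
  obtain D F i where i: "i div 2 = Q" and s: "steep D F (low P) (unb P) (W i) (col Q) (col R)"
    and b: "\<And>w i'. w \<in> col R \<Longrightarrow> D + W i w = F \<Longrightarrow> F < low P w \<Longrightarrow> i' div 2 = Q \<Longrightarrow> W i' w \<le> W i w"
    using ex_base_row[OF PQR st] by blast
  have DF: "0 < D" "D \<le> F" using s by (auto simp: steep_def)
  \<comment> \<open>For columns in \<open>Q\<close> the two degrees are \<open>D\<close> and
    \<open>F + W k w > D\<close>, so no cancellation occurs and either row of \<open>R\<close> could
    be chosen.\<close>
  have k: "(2 * R) div 2 = R" by simp
  have "line_ok D (F + W (2 * R) w) (low P w) (unb P w) \<and> D \<noteq> F + W (2 * R) w" if "w \<in> col Q" for w
  proof -
    have "0 < W (2 * R) w" using pos[OF PQR(2,3) PQR(6)[symmetric]] that by simp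
    moreover have "low P w \<le> D \<and> (unb P w \<longrightarrow> low P w = D)" using s that by (simp add: steep_def)
    ultimately show ?thesis using DF by (auto simp: line_ok_def)
  qed
  then have 1: "pair_fits W col P Q R D F (2 * R)" by (simp add: pair_fits_def fits_at_def low_def unb_def)
  have "line_ok F (D + W i w) (low P w) (unb P w)" if "w \<in> col R" for w
  proof -
    have "line_ok (D + W i w) F (low P w) (unb P w)" using s that by (simp add: steep_def)
    then show ?thesis by (auto simp: line_ok_def min.commute)
  qed
  then have 2: "pair_fits W col P R Q F D i"
    using b unfolding pair_fits_def fits_at_def low_def unb_def by (metis)
  show ?thesis using 1 2 DF i k by (intro exI[of _ D] exI[of _ F] exI[of _ i] exI[of _ "2 * R"]) simp
qed

theorem ex_pair_fits:
  assumes PQR: "P < 3" "Q < 3" "R < 3" "P \<noteq> Q" "P \<noteq> R" "Q \<noteq> R"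
  shows "\<exists>D F i k. 0 < D \<and> 0 < F \<and> i div 2 = Q \<and> k div 2 = R \<and>
    pair_fits W col P Q R D F k \<and> pair_fits W col P R Q F D i"
proof -
  have PRQ: "P < 3" "R < 3" "Q < 3" "P \<noteq> R" "P \<noteq> Q" "R \<noteq> Q" using PQR by auto
  show ?thesis using steep_either[OF PQR] steep_pair_fits[OF PQR] steep_pair_fits[OF PRQ] by blast
qed

end

section \<open>Lifting columns\<close>

text \<open>Membership in the valuation ring, with residue map \<open>res\<close>.\<close>

definition hint :: "hahn \<Rightarrow> bool" where
  "hint f \<longleftrightarrow> (\<forall>e<0. hcoeff f e = 0)"

abbreviation res :: "hahn \<Rightarrow> complex" where
  "res f \<equiv> hcoeff f 0"

lemma hint_mult [simp]:
  assumes "hint f" "hint g"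
  shows "hint (f * g)"
  unfolding hint_def
proof (intro allI impI, rule ccontr)
  fix e :: real assume "e < 0" "hcoeff (f * g) e \<noteq> 0"
  then obtain a where "hcoeff f a \<noteq> 0" "hcoeff g (e - a) \<noteq> 0" by (auto elim: hcoeff_mult_nonzeroD)
  then have "0 \<le> a" "0 \<le> e - a" using assms unfolding hint_def by (meson not_le)+
  then show False using \<open>e < 0\<close> by simp
qed

lemma res_mult [simp]:
  assumes "hint f" "hint g"
  shows "res (f * g) = res f * res g"
proof -
  have "res (f * g) = (\<Sum>a\<in>{0}. hcoeff f a * hcoeff g (0 - a))"
  proof (rule hcoeff_mult_sum)
    fix a assume "hcoeff f a \<noteq> 0" "hcoeff g (0 - a) \<noteq> 0"
    then have "0 \<le> a" "0 \<le> 0 - a" using assms unfolding hint_def by (meson not_le)+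
    then show "a \<in> {0}" by simp
  qed simp
  then show ?thesis by simp
qed

lemma hint_simps [simp]:
  "hint 0" "hint 1" "hint f \<Longrightarrow> hint g \<Longrightarrow> hint (f + g)" "hint f \<Longrightarrow> hint g \<Longrightarrow> hint (f - g)"
  "hint f \<Longrightarrow> hint (- f)"
  by (simp_all add: hint_def hcoeff_1)

lemma res_1 [simp]: "res 1 = 1"
  by (simp add: hcoeff_1)

lemma hint_hmonom [simp]: "0 \<le> e \<Longrightarrow> hint (hmonom a e)"
  by (auto simp: hint_def hcoeff_hmonom)

lemma res_hmonom [simp]: "res (hmonom a e) = (if e = 0 then a else 0)"
  by (simp add: hcoeff_hmonom)

lemma hmonom_mult: "hmonom a r * hmonom b s = hmonom (a * b) (r + s)"
  by (rule hahn_eqI) (auto simp: hcoeff_hmonom_mult hcoeff_hmonom)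

lemma hmonom_mult_left: "hmonom a r * (hmonom b s * x) = hmonom (a * b) (r + s) * x"
  by (simp add: hmonom_mult flip: mult.assoc)

lemma hmonom_1_0 [simp]: "hmonom 1 0 = 1"
  by (rule hahn_eqI) (simp add: hcoeff_hmonom hcoeff_1)

lemma hmonom_minus: "- hmonom a r = hmonom (- a) r"
  by (rule hahn_eqI) (simp add: hcoeff_hmonom)

lemma hdeg_hmonom_mult:
  assumes "hint x" "res x \<noteq> 0"
  shows "hdeg (hmonom 1 r * x) = ereal r"
  using assms by (auto simp: hdeg_eq_ereal_iff hcoeff_hmonom_mult hint_def)

lemma hdeg_hmonom: "a \<noteq> 0 \<Longrightarrow> hdeg (hmonom a r) = ereal r"
  by (auto simp: hdeg_eq_ereal_iff hcoeff_hmonom)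

lemma hdeg_shift:
  assumes "hdeg x = ereal e"
  shows "hdeg (hmonom 1 r * x) = ereal (r + e)"
  using assms by (auto simp: hdeg_eq_ereal_iff hcoeff_hmonom_mult)

text \<open>\<open>1 - n\<close> has residue 1, hence is a unit of the valuation ring: if the
  inverse had leading exponent \<open>x\<close>, comparing residues after rescaling it by
  \<open>hmonom 1 (- x)\<close> forces \<open>x = 0\<close>.\<close>

lemma inverse_one_minus:
  assumes "hint n" "res n = 0"
  shows "hint (inverse (1 - n))" "res (inverse (1 - n)) = 1" "1 - n \<noteq> 0"
proof -
  have "res (1 - n) \<noteq> 0" using assms by simp
  then show ne: "1 - n \<noteq> 0" by (metis hcoeff_0)
  then have e: "(1 - n) * inverse (1 - n) = 1" by simp
  show i: "hint (inverse (1 - n))"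
  proof -
    have "inverse (1 - n) \<noteq> 0" using ne by simp
    then obtain x where x: "hcoeff (inverse (1 - n)) x \<noteq> 0" "\<And>y. y < x \<Longrightarrow> hcoeff (inverse (1 - n)) y = 0"
      using hahn_least_exponent by blast
    define g where "g = hmonom 1 (- x) * inverse (1 - n)"
    have g: "hint g" "res g \<noteq> 0" using x by (auto simp: g_def hint_def hcoeff_hmonom_mult)
    have "(1 - n) * g = hmonom 1 (- x)" using e by (simp add: g_def mult.left_commute)
    then have "res (hmonom 1 (- x)) \<noteq> 0" using res_mult[of "1 - n" g] g assms by simp
    then have "x = 0" by (simp split: if_splits)
    then show ?thesis using x(2) by (simp add: hint_def)
  qed
  show "res (inverse (1 - n)) = 1" using res_mult[of "1 - n" "inverse (1 - n)"] assms i e by simp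
qed

text \<open>Modulo positive degree the system is lower unitriangular. Eliminating \<open>x3\<close>
  and then \<open>x2\<close> divides only by units \<open>1 - m\<close> and \<open>1 - n\<close>,
  and the residues follow by forward substitution.\<close>

lemma triangular_system:
  fixes a12 :: hahn
  assumes int: "hint r1" "hint r2" "hint r3" "hint a12" "hint a13" "hint a21" "hint a23" "hint a31" "hint a32"
    and small: "res a12 = 0" "res a13 = 0" "res a23 = 0"
  obtains x1 x2 x3 where
    "x1 = r1 + a12 * x2 + a13 * x3" "x2 = r2 + a21 * x1 + a23 * x3" "x3 = r3 + a31 * x1 + a32 * x2"
    "hint x1" "hint x2" "hint x3"
    "res x1 = res r1" "res x2 = res r2 + res a21 * res r1"
    "res x3 = res r3 + res a31 * res x1 + res a32 * res x2"
proof -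
  define m where "m = a23 * a32"
  define u where "u = inverse (1 - m)"
  have m: "hint m" "res m = 0" using int small by (simp_all add: m_def)
  note u = inverse_one_minus[OF m, folded u_def]
  define r2' where "r2' = u * (r2 + a23 * r3)"
  define a21' where "a21' = u * (a21 + a23 * a31)"
  have 2: "hint r2'" "hint a21'" "res r2' = res r2" "res a21' = res a21"
    using int small u by (simp_all add: r2'_def a21'_def)
  define n where "n = a12 * a21' + a13 * (a31 + a32 * a21')"
  define v where "v = inverse (1 - n)"
  have n: "hint n" "res n = 0" using int small 2 by (simp_all add: n_def)
  note v = inverse_one_minus[OF n, folded v_def]
  define x1 where "x1 = v * (r1 + a12 * r2' + a13 * (r3 + a32 * r2'))"
  define x2 where "x2 = r2' + a21' * x1"
  define x3 where "x3 = r3 + a31 * x1 + a32 * x2"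
  have i: "hint x1" "res x1 = res r1" using int small 2 v by (simp_all add: x1_def)
  have i2: "hint x2" "res x2 = res r2 + res a21 * res r1" using int i 2 by (simp_all add: x2_def)
  have i3: "hint x3" "res x3 = res r3 + res a31 * res x1 + res a32 * res x2"
    using int i(1) i2(1) by (simp_all add: x3_def)
  have "(1 - n) * x1 = r1 + a12 * r2' + a13 * (r3 + a32 * r2')"
    using v(3) by (simp add: x1_def v_def)
  then have e1: "x1 = r1 + a12 * x2 + a13 * x3"
    by (simp add: n_def x2_def x3_def algebra_simps)
  have "x2 = u * (r2 + a23 * r3 + (a21 + a23 * a31) * x1)"
    by (simp add: x2_def r2'_def a21'_def algebra_simps)
  then have "(1 - m) * x2 = r2 + a23 * r3 + (a21 + a23 * a31) * x1"
    using u(3) by (simp add: u_def)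
  then have e2: "x2 = r2 + a21 * x1 + a23 * x3"
    by (simp add: m_def x3_def algebra_simps)
  show thesis using that[OF e1 e2 x3_def i(1) i2(1) i3(1) i(2) i2(2) i3(2)] .
qed

section \<open>Lifts of a single column in normalized position\<close>

definition sel :: "bool \<Rightarrow> 'a \<Rightarrow> 'a \<Rightarrow> 'a" where
  "sel s x y = (if s then x else y)"

lemma norm_sum_ne_0:
  fixes a b :: complex
  assumes "norm b < norm a"
  shows "a + b \<noteq> 0"
  using assms by (metis add_eq_0_iff2 less_irrefl norm_minus_cancel)

text \<open>The larger entries of both pairs are prescribed as monomials and the other entries solve a linear
  system which is triangular modulo positive degree. The coefficients \<open>5\<close> and \<open>20\<close> are far enough from
  \<open>2\<close> and from each other to exclude cancellation of leading terms.\<close>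

lemma column_lift_generic:
  fixes b0 c0 d0 f0 g0 h0 :: complex
  assumes pos: "0 < B" "0 < C" "0 < D" "0 < F" "0 < G" "0 < H" "0 < Pg" "0 < Qg"
    and norms: "norm d0 = 2" "norm f0 = 2" "norm g0 = 2"
    and ord: "Qg \<le> Qe" "Pg \<le> Pe" "Qg \<le> Pg"
    and Q: "Qg \<le> G" "Qg < Qe \<Longrightarrow> G = Qg"
    and P: "Pg \<le> D" "Pg \<le> F + sel jf Qe Qg" "Pg < Pe \<Longrightarrow> D = Pg \<or> F + sel jf Qe Qg = Pg"
  shows "\<exists>\<tau> pe pg qe qg. hdeg \<tau> = ereal 0 \<and> hdeg pe = ereal Pe \<and> hdeg pg = ereal Pg \<and>
    hdeg qe = ereal Qe \<and> hdeg qg = ereal Qg \<and>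
    \<tau> = 1 + hmonom b0 B * sel jb pe pg + hmonom c0 C * sel jc qe qg \<and>
    qg = qe + hmonom g0 G * sel jg 1 \<tau> + hmonom h0 H * sel jh pe pg \<and>
    pg = pe + hmonom d0 D * sel jd 1 \<tau> + hmonom f0 F * sel jf qe qg"
proof -
  define pe where "pe = hmonom 20 Pe"
  define qe where "qe = hmonom 5 Qe"
  \<comment> \<open>The unknowns \<open>x1, x2, x3\<close> are \<open>\<tau>\<close>,
    \<open>qg\<close> and \<open>pg\<close> divided by the monomials of degrees \<open>0\<close>,
    \<open>Qg\<close> and \<open>Pg\<close>. The assumption \<open>Qg \<le> Pg\<close> gives
    \<open>a23\<close> positive degree.\<close>
  define r1 where "r1 = 1 + sel jb (hmonom (b0 * 20) (B + Pe)) 0 + sel jc (hmonom (c0 * 5) (C + Qe)) 0"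
  define a12 where "a12 = sel jc 0 (hmonom c0 (C + Qg))"
  define a13 where "a13 = sel jb 0 (hmonom b0 (B + Pg))"
  define r2 where "r2 = hmonom 5 (Qe - Qg) + sel jg (hmonom g0 (G - Qg)) 0 + sel jh (hmonom (h0 * 20) (H + Pe - Qg)) 0"
  define a21 where "a21 = sel jg 0 (hmonom g0 (G - Qg))"
  define a23 where "a23 = sel jh 0 (hmonom h0 (H + Pg - Qg))"
  define r3 where "r3 = hmonom 20 (Pe - Pg) + sel jd (hmonom d0 (D - Pg)) 0 + sel jf (hmonom (f0 * 5) (F + Qe - Pg)) 0"
  define a31 where "a31 = sel jd 0 (hmonom d0 (D - Pg))"
  define a32 where "a32 = sel jf 0 (hmonom f0 (F + Qg - Pg))"
  note defs = r1_def a12_def a13_def r2_def a21_def a23_def r3_def a31_def a32_def sel_def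
  have int: "hint r1" "hint r2" "hint r3" "hint a12" "hint a13" "hint a21" "hint a23" "hint a31" "hint a32"
    using pos ord Q(1) P(1,2) by (auto simp: defs)
  have small: "res a12 = 0" "res a13 = 0" "res a23 = 0" using pos ord by (auto simp: defs)
  obtain x1 x2 x3 where x: "x1 = r1 + a12 * x2 + a13 * x3" "x2 = r2 + a21 * x1 + a23 * x3"
    "x3 = r3 + a31 * x1 + a32 * x2" "hint x1" "hint x2" "hint x3"
    and rs: "res x1 = res r1" "res x2 = res r2 + res a21 * res r1"
    "res x3 = res r3 + res a31 * res x1 + res a32 * res x2"
    using triangular_system[OF int small] by metis
  have R1: "res r1 = 1" using pos ord by (auto simp: defs)
  have R2: "res x2 = (if Qe = Qg then 5 else 0) + (if G = Qg then g0 else 0)"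
    using pos ord R1 rs(2) by (auto simp: defs)
  have R3: "res x3 = (if Pe = Pg then 20 else 0) + (if D = Pg then d0 else 0) +
     (if F + sel jf Qe Qg = Pg then f0 * sel jf 5 (res x2) else 0)"
    using pos ord R1 rs(1,3) by (auto simp: defs)
  have n2: "res x2 \<noteq> 0" "norm (res x2) \<le> 7" "3 \<le> norm (res x2) \<or> (res x2 = g0)"
  proof -
    have "norm (5 + g0) \<le> 7" using norm_triangle_ineq[of 5 g0] norms by simp
    moreover have "3 \<le> norm (5 + g0)" using norm_diff_ineq[of 5 g0] norms by simp
    ultimately show "norm (res x2) \<le> 7" "3 \<le> norm (res x2) \<or> (res x2 = g0)" "res x2 \<noteq> 0"
      using Q(2) ord norms unfolding R2 by (auto split: if_splits)
  qed
  \<comment> \<open>The residue of \<open>x2\<close> has norm between 2 and 7. Hence the last term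
    has norm between 4 and 14: it cannot cancel \<open>d0\<close> of norm 2, and together with
    \<open>d0\<close> it cannot cancel 20.\<close>
  have k: "4 \<le> norm (f0 * sel jf 5 (res x2))" "norm (f0 * sel jf 5 (res x2)) \<le> 14"
    using n2 norms by (auto simp: sel_def norm_mult)
  have n3: "res x3 \<noteq> 0"
  proof (cases "Pe = Pg")
    case True
    define z where "z = (if D = Pg then d0 else 0) + (if F + sel jf Qe Qg = Pg then f0 * sel jf 5 (res x2) else 0)"
    have "norm z \<le> 2 + 14" unfolding z_def
      by (rule norm_triangle_mono) (use norms k in auto)
    then have "norm z < norm (20 :: complex)" by simp
    then show ?thesis using norm_sum_ne_0[of z 20] True unfolding R3 z_def by (simp add: add.assoc)
  next
    case False
    then have "D = Pg \<or> F + sel jf Qe Qg = Pg" using P(3) ord by simp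
    then show ?thesis using False k norms norm_sum_ne_0[of d0 "f0 * sel jf 5 (res x2)"] unfolding R3
      by (auto simp: add.commute)
  qed
  define qg where "qg = hmonom 1 Qg * x2"
  define pg where "pg = hmonom 1 Pg * x3"
  have "x1 = 1 + hmonom b0 B * sel jb pe pg + hmonom c0 C * sel jc qe qg"
    by (subst x(1)) (simp add: defs pe_def pg_def qe_def qg_def hmonom_mult hmonom_mult_left)
  moreover have "qg = qe + hmonom g0 G * sel jg 1 x1 + hmonom h0 H * sel jh pe pg"
    unfolding qg_def
    by (subst x(2)) (simp add: defs pe_def pg_def qe_def hmonom_mult hmonom_mult_left distrib_left)
  moreover have "pg = pe + hmonom d0 D * sel jd 1 x1 + hmonom f0 F * sel jf qe qg"
    unfolding pg_def
    by (subst x(3)) (simp add: defs pe_def qg_def qe_def hmonom_mult hmonom_mult_left distrib_left)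
  moreover have "hdeg x1 = ereal 0" using hdeg_hmonom_mult[of x1 0] x(4) rs(1) R1 by simp
  moreover have "hdeg qg = ereal Qg" "hdeg pg = ereal Pg"
    unfolding qg_def pg_def using hdeg_hmonom_mult x(5,6) n2(1) n3 by simp_all
  moreover have "hdeg pe = ereal Pe" "hdeg qe = ereal Qe" by (simp_all add: pe_def qe_def hdeg_hmonom)
  ultimately show ?thesis by blast
qed

text \<open>Here the difference \<open>pg - pe\<close> has larger degree than the two terms of its relation, so the relation
  is solved for \<open>qe\<close> instead.\<close>

lemma column_lift_cancelling:
  fixes b0 c0 d0 f0 g0 h0 :: complex
  assumes pos: "0 < B" "0 < C" "0 < H" "0 < Pg" "0 < Qg"
    and norms: "norm d0 = 2" "norm f0 = 2" "norm g0 = 2"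
    and ord: "Qg \<le> Qe" "Pg \<le> Pe" "Qg \<le> Pg"
    and Q: "Qg \<le> G" "Qg < Qe \<Longrightarrow> G = Qg"
    and jf: "jf" and P: "D = F + sel jf Qe Qg" "D < Pg"
  shows "\<exists>\<tau> pe pg qe qg. hdeg \<tau> = ereal 0 \<and> hdeg pe = ereal Pe \<and> hdeg pg = ereal Pg \<and>
    hdeg qe = ereal Qe \<and> hdeg qg = ereal Qg \<and>
    \<tau> = 1 + hmonom b0 B * sel jb pe pg + hmonom c0 C * sel jc qe qg \<and>
    qg = qe + hmonom g0 G * sel jg 1 \<tau> + hmonom h0 H * sel jh pe pg \<and>
    pg = pe + hmonom d0 D * sel jd 1 \<tau> + hmonom f0 F * sel jf qe qg"
proof -
  have P: "D = F + Qe" "D < Pg" using P jf by (simp_all add: sel_def)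
  define pe where "pe = hmonom 1 Pe"
  define pg where "pg = hmonom 1 Pg"
  have f0: "f0 \<noteq> 0" using norms by auto
  define r1 where "r1 = 1 + hmonom b0 (B + sel jb Pe Pg)"
  define a12 where "a12 = sel jc (hmonom c0 (C + Qe)) 0"
  define a13 where "a13 = sel jc 0 (hmonom c0 (C + Qg))"
  \<comment> \<open>Now \<open>x2\<close> is \<open>qe\<close> divided by its monomial, obtained
    from the relation for the pair \<open>P\<close>, and \<open>x3\<close> belongs to
    \<open>qg\<close>. The residue of \<open>x2\<close> is \<open>- (d0 / f0)\<close>, of norm 1, so
    it cannot cancel \<open>g0\<close> of norm 2.\<close>
  define r2 where "r2 = hmonom (1 / f0) (Pg - F - Qe) - hmonom (1 / f0) (Pe - F - Qe) - sel jd (hmonom (d0 / f0) 0) 0"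
  define a21 where "a21 = - sel jd 0 (hmonom (d0 / f0) 0)"
  define r3 where "r3 = sel jg (hmonom g0 (G - Qg)) 0 + hmonom h0 (H + sel jh Pe Pg - Qg)"
  define a31 where "a31 = sel jg 0 (hmonom g0 (G - Qg))"
  define a32 where "a32 = hmonom 1 (Qe - Qg)"
  note defs = r1_def a12_def a13_def r2_def a21_def r3_def a31_def a32_def sel_def
  have int: "hint r1" "hint r2" "hint r3" "hint a12" "hint a13" "hint a21" "hint 0" "hint a31" "hint a32"
    using pos ord Q(1) P(1,2) by (auto simp: defs)
  have small: "res a12 = 0" "res a13 = 0" "res 0 = 0" using pos ord by (auto simp: defs)
  obtain x1 x2 x3 where x: "x1 = r1 + a12 * x2 + a13 * x3" "x2 = r2 + a21 * x1 + 0 * x3"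
    "x3 = r3 + a31 * x1 + a32 * x2" "hint x1" "hint x2" "hint x3"
    and rs: "res x1 = res r1" "res x2 = res r2 + res a21 * res r1"
    "res x3 = res r3 + res a31 * res x1 + res a32 * res x2"
    using triangular_system[OF int small] by metis
  have R1: "res r1 = 1" using pos ord by (auto simp: defs)
  have R2: "res x2 = - (d0 / f0)" using pos ord P R1 rs(2) by (auto simp: defs)
  have R3: "res x3 = (if G = Qg then g0 else 0) + (if Qe = Qg then - (d0 / f0) else 0)"
    using pos ord R1 rs(1,3) R2 by (auto simp: defs)
  have n: "norm (d0 / f0) = 1" using norms by (simp add: norm_divide)
  then have n2: "res x2 \<noteq> 0" using R2 by auto
  have n3: "res x3 \<noteq> 0"
    using norm_sum_ne_0[of "- (d0 / f0)" g0] n norms Q(2) ord unfolding R3 by auto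
  define qe where "qe = hmonom 1 Qe * x2"
  define qg where "qg = hmonom 1 Qg * x3"
  have "x1 = 1 + hmonom b0 B * sel jb pe pg + hmonom c0 C * sel jc qe qg"
    by (subst x(1)) (simp add: defs pe_def pg_def qe_def qg_def hmonom_mult hmonom_mult_left)
  moreover have "qg = qe + hmonom g0 G * sel jg 1 x1 + hmonom h0 H * sel jh pe pg"
    unfolding qg_def
    by (subst x(3)) (simp add: defs pe_def pg_def qe_def hmonom_mult hmonom_mult_left distrib_left)
  moreover have "hmonom f0 F * qe = pg - pe - hmonom d0 D * sel jd 1 x1"
    unfolding qe_def
    by (subst x(2)) (use f0 P(1) in \<open>simp add: defs pe_def pg_def hmonom_mult hmonom_mult_left algebra_simps flip: hmonom_minus\<close>)
  then have "pg = pe + hmonom d0 D * sel jd 1 x1 + hmonom f0 F * sel jf qe qg"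
    using jf by (simp add: sel_def)
  moreover have "hdeg x1 = ereal 0" using hdeg_hmonom_mult[of x1 0] x(4) rs(1) R1 by simp
  moreover have "hdeg qg = ereal Qg" "hdeg qe = ereal Qe"
    unfolding qg_def qe_def using hdeg_hmonom_mult x(5,6) n2 n3 by simp_all
  moreover have "hdeg pe = ereal Pe" "hdeg pg = ereal Pg" by (simp_all add: pe_def pg_def hdeg_hmonom)
  ultimately show ?thesis by blast
qed

lemma sel_simps [simp]: "sel True x y = x" "sel False x y = y"
  by (simp_all add: sel_def)

text \<open>Because \<open>Qg \<le> Pg\<close>, the term of degree \<open>H + sel jh Pe Pg\<close>
  lies above \<open>Qg\<close>, so the relation for \<open>Q\<close> is governed by \<open>G\<close>
  alone. Only the relation for \<open>P\<close> can cancel, which separates the two preceding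
  cases.\<close>

lemma column_lift_oriented:
  fixes b0 c0 d0 f0 g0 h0 :: complex
  assumes pos: "0 < B" "0 < C" "0 < D" "0 < F" "0 < G" "0 < H" "0 < Pg" "0 < Qg"
    and norms: "norm d0 = 2" "norm f0 = 2" "norm g0 = 2"
    and ord: "Qg \<le> Qe" "Pg \<le> Pe" "Qg \<le> Pg"
    and Q: "line_ok G (H + sel jh Pe Pg) Qg (Qg < Qe)"
    and P: "line_ok D (F + sel jf Qe Qg) Pg (Pg < Pe)" "D = F + sel jf Qe Qg \<Longrightarrow> D < Pg \<Longrightarrow> jf"
  shows "\<exists>\<tau> pe pg qe qg. hdeg \<tau> = ereal 0 \<and> hdeg pe = ereal Pe \<and> hdeg pg = ereal Pg \<and>
    hdeg qe = ereal Qe \<and> hdeg qg = ereal Qg \<and>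
    \<tau> = 1 + hmonom b0 B * sel jb pe pg + hmonom c0 C * sel jc qe qg \<and>
    qg = qe + hmonom g0 G * sel jg 1 \<tau> + hmonom h0 H * sel jh pe pg \<and>
    pg = pe + hmonom d0 D * sel jd 1 \<tau> + hmonom f0 F * sel jf qe qg"
proof -
  have "Qg < H + sel jh Pe Pg" using pos ord by (auto simp: sel_def)
  then have Q': "Qg \<le> G" "Qg < Qe \<Longrightarrow> G = Qg"
    using Q by (auto simp: line_ok_def min_def split: if_splits)
  show ?thesis
  proof (cases "D = F + sel jf Qe Qg \<and> D < Pg")
    case True
    then have "jf" using P(2) by blast
    show ?thesis
      by (rule column_lift_cancelling[OF pos(1,2,6,7,8) norms ord Q']) (use True \<open>jf\<close> in simp_all)
  next
    case False
    have N: "Pg \<le> D" "Pg \<le> F + sel jf Qe Qg" "Pg < Pe \<Longrightarrow> D = Pg \<or> F + sel jf Qe Qg = Pg"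
      using P(1) False by (auto simp: line_ok_def min_def split: if_splits)
    show ?thesis by (rule column_lift_generic[OF pos norms ord Q' N])
  qed
qed

text \<open>Naming the smaller row of a pair second may exchange its rows, which changes the signs
  in the relation. This is why the coefficients were kept general with norm 2.\<close>

lemma column_lift_ordered:
  fixes b0 c0 d0 f0 g0 h0 :: complex
  assumes pos: "0 < B" "0 < C" "0 < D" "0 < F" "0 < G" "0 < H" "0 < P0" "0 < P1" "0 < Q0" "0 < Q1"
    and norms: "norm d0 = 2" "norm f0 = 2" "norm g0 = 2"
    and ord: "min Q0 Q1 \<le> min P0 P1"
    and Q: "line_ok G (H + sel jh P0 P1) (min Q0 Q1) (Q0 \<noteq> Q1)"
    and P: "line_ok D (F + sel jf Q0 Q1) (min P0 P1) (P0 \<noteq> P1)"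
      "D = F + sel jf Q0 Q1 \<Longrightarrow> D < min P0 P1 \<Longrightarrow> Q0 \<le> sel jf Q0 Q1 \<and> Q1 \<le> sel jf Q0 Q1"
  shows "\<exists>\<tau> p0 p1 q0 q1. hdeg \<tau> = ereal 0 \<and> hdeg p0 = ereal P0 \<and> hdeg p1 = ereal P1 \<and>
    hdeg q0 = ereal Q0 \<and> hdeg q1 = ereal Q1 \<and>
    \<tau> = 1 + hmonom b0 B * sel jb p0 p1 + hmonom c0 C * sel jc q0 q1 \<and>
    q1 = q0 + hmonom g0 G * sel jg 1 \<tau> + hmonom h0 H * sel jh p0 p1 \<and>
    p1 = p0 + hmonom d0 D * sel jd 1 \<tau> + hmonom f0 F * sel jf q0 q1"
proof -
  define s where "s \<longleftrightarrow> P1 \<le> P0"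
  \<comment> \<open>A tie in \<open>Q\<close> is broken by \<open>jf\<close>, so that in the
    cancelling case the row used by the relation for \<open>P\<close> is the one treated as
    larger.\<close>
  define r where "r \<longleftrightarrow> Q1 < Q0 \<or> (Q0 = Q1 \<and> jf)"
  define sg where "sg u z = (if u then z else - z)" for u and z :: complex
  have sw: "sel (j = u) (sel u x y) (sel u y x) = sel j x y" for j u and x y :: 'z
    by (auto simp: sel_def)
  have mins: "min P0 P1 = sel s P1 P0" "min Q0 Q1 = sel r Q1 Q0" by (auto simp: s_def r_def sel_def)
  have lt: "(P0 \<noteq> P1) = (sel s P1 P0 < sel s P0 P1)" "(Q0 \<noteq> Q1) = (sel r Q1 Q0 < sel r Q0 Q1)"
    by (auto simp: s_def r_def sel_def)
  have jf: "jf = r" if "D = F + sel jf Q0 Q1" "D < min P0 P1"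
    using P(2)[OF that] by (auto simp: r_def sel_def split: if_splits)
  have "\<exists>\<tau> pe pg qe qg. hdeg \<tau> = ereal 0 \<and> hdeg pe = ereal (sel s P0 P1) \<and> hdeg pg = ereal (sel s P1 P0) \<and>
    hdeg qe = ereal (sel r Q0 Q1) \<and> hdeg qg = ereal (sel r Q1 Q0) \<and>
    \<tau> = 1 + hmonom b0 B * sel (jb = s) pe pg + hmonom c0 C * sel (jc = r) qe qg \<and>
    qg = qe + hmonom (sg r g0) G * sel jg 1 \<tau> + hmonom (sg r h0) H * sel (jh = s) pe pg \<and>
    pg = pe + hmonom (sg s d0) D * sel jd 1 \<tau> + hmonom (sg s f0) F * sel (jf = r) qe qg"
  proof (rule column_lift_oriented)
    show "line_ok G (H + sel (jh = s) (sel s P0 P1) (sel s P1 P0)) (sel r Q1 Q0) (sel r Q1 Q0 < sel r Q0 Q1)"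
      using Q unfolding mins lt sw .
    show "line_ok D (F + sel (jf = r) (sel r Q0 Q1) (sel r Q1 Q0)) (sel s P1 P0) (sel s P1 P0 < sel s P0 P1)"
      using P(1) unfolding mins lt sw .
    show "jf = r" if "D = F + sel (jf = r) (sel r Q0 Q1) (sel r Q1 Q0)" "D < sel s P1 P0"
      using jf that unfolding mins sw by blast
    show "sel r Q1 Q0 \<le> sel s P1 P0" using ord unfolding mins .
  qed (use pos norms in \<open>auto simp: sg_def sel_def s_def r_def\<close>)
  then obtain \<tau> pe pg qe qg where deg: "hdeg \<tau> = ereal 0" "hdeg pe = ereal (sel s P0 P1)" "hdeg pg = ereal (sel s P1 P0)"
    "hdeg qe = ereal (sel r Q0 Q1)" "hdeg qg = ereal (sel r Q1 Q0)"
    and eqs: "\<tau> = 1 + hmonom b0 B * sel (jb = s) pe pg + hmonom c0 C * sel (jc = r) qe qg"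
    "qg = qe + hmonom (sg r g0) G * sel jg 1 \<tau> + hmonom (sg r h0) H * sel (jh = s) pe pg"
    "pg = pe + hmonom (sg s d0) D * sel jd 1 \<tau> + hmonom (sg s f0) F * sel (jf = r) qe qg"
    by (elim exE conjE) (rule that; assumption)
  show ?thesis
  proof (intro exI conjI)
    show "hdeg \<tau> = ereal 0" by fact
    show "hdeg (sel s pe pg) = ereal P0" "hdeg (sel s pg pe) = ereal P1"
      "hdeg (sel r qe qg) = ereal Q0" "hdeg (sel r qg qe) = ereal Q1"
      using deg by (auto simp: sel_def split: if_splits)
    have sl: "sel j (sel u x y) (sel u y x) = sel (j = u) x y" for j u and x y :: hahn
      by (auto simp: sel_def)
    show "\<tau> = 1 + hmonom b0 B * sel jb (sel s pe pg) (sel s pg pe) + hmonom c0 C * sel jc (sel r qe qg) (sel r qg qe)"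
      unfolding sl by (rule eqs(1))
    show "sel r qg qe = sel r qe qg + hmonom g0 G * sel jg 1 \<tau> + hmonom h0 H * sel jh (sel s pe pg) (sel s pg pe)"
      unfolding sl using eqs(2) by (cases r) (simp_all add: sg_def flip: hmonom_minus)
    show "sel s pg pe = sel s pe pg + hmonom d0 D * sel jd 1 \<tau> + hmonom f0 F * sel jf (sel r qe qg) (sel r qg qe)"
      unfolding sl using eqs(3) by (cases s) (simp_all add: sg_def flip: hmonom_minus)
  qed
qed

section \<open>Lifts of columns with six rows, and the rank bound\<close>

lemma sel_row:
  fixes r Q :: nat
  assumes "r div 2 = Q"
  shows "f r = sel (r = 2 * Q) (f (2 * Q)) (f (2 * Q + 1))"
proof -
  have "r = 2 * Q \<or> r = 2 * Q + 1" using assms by linarith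
  then show ?thesis by (auto simp: sel_def)
qed

definition pair_relations :: "(nat \<Rightarrow> nat \<Rightarrow> real) \<Rightarrow> (nat \<Rightarrow> nat \<Rightarrow> nat) \<Rightarrow> (nat \<Rightarrow> hahn) \<Rightarrow> bool" where
  "pair_relations c bs x \<longleftrightarrow> (\<forall>i<3. x (2 * i + 1) = x (2 * i) +
     (\<Sum>j\<in>{..<3} - {i}. hmonom 2 (c i j) * x (bs i j)))"

text \<open>On the pair \<open>T\<close>, where the column vanishes, the lift is normalized to
  \<open>1\<close> in row \<open>2 * T\<close>; row \<open>2 * T + 1\<close> becomes the unknown
  \<open>\<tau>\<close>.\<close>

lemma column_lift_aux:
  fixes w :: "nat \<Rightarrow> real"
  assumes TPQ: "T < 3" "P < 3" "Q < 3" "T \<noteq> P" "T \<noteq> Q" "P \<noteq> Q"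
    and cpos: "\<And>i j. 0 < c i j"
    and bs: "\<And>i j. bs i j div 2 = j"
    and w: "\<And>r. r div 2 = T \<Longrightarrow> w r = 0" "\<And>r. r div 2 \<in> {P, Q} \<Longrightarrow> 0 < w r"
    and fits: "fits_at w P Q (c P T) (c P Q) (bs P Q)" "fits_at w Q P (c Q T) (c Q P) (bs Q P)"
    and ord: "min (w (2 * Q)) (w (2 * Q + 1)) \<le> min (w (2 * P)) (w (2 * P + 1))"
  shows "\<exists>x. (\<forall>r<6. hdeg (x r) = ereal (w r)) \<and> pair_relations c bs x"
proof -
  define j where "j P Q \<longleftrightarrow> bs P Q = 2 * Q" for P Q
  note sb = sel_row[OF bs, folded j_def]
  have wsel: "w (bs P Q) = sel (j P Q) (w (2 * Q)) (w (2 * Q + 1))"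
    "w (bs Q P) = sel (j Q P) (w (2 * P)) (w (2 * P + 1))" by (rule sb)+
  have wpos: "0 < w (2 * P)" "0 < w (2 * P + 1)" "0 < w (2 * Q)" "0 < w (2 * Q + 1)"
    using w(2) by simp_all
  have n2: "norm (2 :: complex) = 2" by simp
  have "\<exists>\<tau> p0 p1 q0 q1. hdeg \<tau> = ereal 0 \<and> hdeg p0 = ereal (w (2 * P)) \<and> hdeg p1 = ereal (w (2 * P + 1)) \<and>
    hdeg q0 = ereal (w (2 * Q)) \<and> hdeg q1 = ereal (w (2 * Q + 1)) \<and>
    \<tau> = 1 + hmonom 2 (c T P) * sel (j T P) p0 p1 + hmonom 2 (c T Q) * sel (j T Q) q0 q1 \<and>
    q1 = q0 + hmonom 2 (c Q T) * sel (j Q T) 1 \<tau> + hmonom 2 (c Q P) * sel (j Q P) p0 p1 \<and>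
    p1 = p0 + hmonom 2 (c P T) * sel (j P T) 1 \<tau> + hmonom 2 (c P Q) * sel (j P Q) q0 q1"
  proof (rule column_lift_ordered[OF cpos cpos cpos cpos cpos cpos wpos n2 n2 n2 ord])
    show "w (2 * Q) \<le> sel (j P Q) (w (2 * Q)) (w (2 * Q + 1)) \<and> w (2 * Q + 1) \<le> sel (j P Q) (w (2 * Q)) (w (2 * Q + 1))"
      if "c P T = c P Q + sel (j P Q) (w (2 * Q)) (w (2 * Q + 1))" "c P T < min (w (2 * P)) (w (2 * P + 1))"
      using fits(1) that unfolding fits_at_def wsel by simp
  qed (use fits in \<open>simp_all only: fits_at_def wsel\<close>)
  then obtain \<tau> p0 p1 q0 q1 where deg: "hdeg \<tau> = ereal 0" "hdeg p0 = ereal (w (2 * P))"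
      "hdeg p1 = ereal (w (2 * P + 1))" "hdeg q0 = ereal (w (2 * Q))" "hdeg q1 = ereal (w (2 * Q + 1))"
    and eqs: "\<tau> = 1 + hmonom 2 (c T P) * sel (j T P) p0 p1 + hmonom 2 (c T Q) * sel (j T Q) q0 q1"
      "q1 = q0 + hmonom 2 (c Q T) * sel (j Q T) 1 \<tau> + hmonom 2 (c Q P) * sel (j Q P) p0 p1"
      "p1 = p0 + hmonom 2 (c P T) * sel (j P T) 1 \<tau> + hmonom 2 (c P Q) * sel (j P Q) q0 q1"
    by (elim exE conjE) (rule that; assumption)
  define x where "x = (\<lambda>_. 0)(2 * T := 1, 2 * T + 1 := \<tau>, 2 * P := p0, 2 * P + 1 := p1, 2 * Q := q0, 2 * Q + 1 := q1)"
  have ne: "2 * a + 1 \<noteq> 2 * b" "2 * b \<noteq> 2 * a + 1" for a b :: nat by presburger+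
  have xv: "x (2 * T) = 1" "x (2 * T + 1) = \<tau>" "x (2 * P) = p0" "x (2 * P + 1) = p1" "x (2 * Q) = q0" "x (2 * Q + 1) = q1"
    unfolding x_def using TPQ ne by (simp_all add: fun_upd_def)
  have xs: "x (bs i T) = sel (j i T) 1 \<tau>" "x (bs i P) = sel (j i P) p0 p1" "x (bs i Q) = sel (j i Q) q0 q1" for i
    by (simp_all only: sb[of x] xv)
  have three: "{..<3} = {T, P, Q}" using TPQ by auto
  have deg1: "hdeg (1 :: hahn) = ereal 0" using hdeg_hmonom[of 1 0] by simp
  have "hdeg (x r) = ereal (w r)" if "r < 6" for r
  proof -
    have "r div 2 \<in> {..<3}" using that by auto
    then consider "r div 2 = T" | "r div 2 = P" | "r div 2 = Q" unfolding three by auto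
    then show ?thesis
      using sel_row[of r T x] sel_row[of r T w] sel_row[of r P x] sel_row[of r P w] sel_row[of r Q x] sel_row[of r Q w]
        deg deg1 w(1)[of "2 * T"] w(1)[of "2 * T + 1"] unfolding xv
      by cases (simp_all add: sel_def)
  qed
  moreover have "pair_relations c bs x"
    unfolding pair_relations_def
  proof (intro allI impI)
    fix i :: nat assume "i < 3"
    then have i: "i = T \<or> i = P \<or> i = Q" using three by blast
    have D: "{..<3} - {T} = {P, Q}" "{..<3} - {P} = {T, Q}" "{..<3} - {Q} = {T, P}"
      unfolding three using TPQ by auto
    have S: "(\<Sum>k\<in>{P, Q}. g k) = g P + g Q" "(\<Sum>k\<in>{T, Q}. g k) = g T + g Q" "(\<Sum>k\<in>{T, P}. g k) = g T + g P"
      for g :: "nat \<Rightarrow> hahn" using TPQ by simp_all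
    have "x (2 * T + 1) = x (2 * T) + (\<Sum>k\<in>{..<3} - {T}. hmonom 2 (c T k) * x (bs T k))"
      unfolding D S xs xv add.assoc[symmetric] by (rule eqs(1))
    moreover have "x (2 * P + 1) = x (2 * P) + (\<Sum>k\<in>{..<3} - {P}. hmonom 2 (c P k) * x (bs P k))"
      unfolding D S xs xv add.assoc[symmetric] by (rule eqs(3))
    moreover have "x (2 * Q + 1) = x (2 * Q) + (\<Sum>k\<in>{..<3} - {Q}. hmonom 2 (c Q k) * x (bs Q k))"
      unfolding D S xs xv add.assoc[symmetric] by (rule eqs(2))
    ultimately show "x (2 * i + 1) = x (2 * i) + (\<Sum>k\<in>{..<3} - {i}. hmonom 2 (c i k) * x (bs i k))"
      using i by (elim disjE) (simp_all only:)
  qed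
  ultimately show ?thesis by blast
qed

lemma column_lift:
  fixes w :: "nat \<Rightarrow> real"
  assumes TPQ: "T < 3" "P < 3" "Q < 3" "T \<noteq> P" "T \<noteq> Q" "P \<noteq> Q"
    and c: "\<And>i j. 0 < c i j" "\<And>i j. bs i j div 2 = j"
    and w: "\<And>r. r div 2 = T \<Longrightarrow> w r = 0" "\<And>r. r div 2 \<in> {P, Q} \<Longrightarrow> 0 < w r"
    and fits: "fits_at w P Q (c P T) (c P Q) (bs P Q)" "fits_at w Q P (c Q T) (c Q P) (bs Q P)"
  shows "\<exists>x. (\<forall>r<6. hdeg (x r) = ereal (w r)) \<and> pair_relations c bs x"
proof (cases "min (w (2 * Q)) (w (2 * Q + 1)) \<le> min (w (2 * P)) (w (2 * P + 1))")
  case True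
  show ?thesis by (rule column_lift_aux[OF TPQ c w fits True])
next
  case False
  have w': "\<And>r. r div 2 \<in> {Q, P} \<Longrightarrow> 0 < w r" using w(2) by blast
  show ?thesis
    by (rule column_lift_aux[OF TPQ(1,3,2,5,4) TPQ(6)[symmetric] c w(1) w' fits(2,1)]) (use False in auto)
qed

text \<open>The three relations determine the odd rows from the even ones, because the linear system for
  the odd rows is a perturbation of the identity by terms of positive degree.\<close>

lemma pair_relations_factor:
  assumes c: "\<And>i j. 0 < c i j" and bs: "\<And>i j. bs i j div 2 = j"
  shows "\<exists>p :: nat \<Rightarrow> nat \<Rightarrow> hahn. \<forall>x. pair_relations c bs x \<longrightarrow> (\<forall>r<6. x r = p r 0 * x 0 + p r 1 * x 2 + p r 2 * x 4)"
proof -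
  have rows: "\<exists>a b. hint a \<and> res a = 0 \<and> hint b \<and> res b = 0 \<and> (\<forall>x. hmonom 2 (c i j) * x (bs i j) = a * x (2 * j) + b * x (2 * j + 1))" for i j
  proof -
    have *: "hint (hmonom 2 (c i j))" "res (hmonom 2 (c i j)) = 0" using c[of i j] by simp_all
    have "bs i j = 2 * j \<or> bs i j = 2 * j + 1" using bs[of i j] by linarith
    then show ?thesis
    proof
      assume "bs i j = 2 * j"
      then show ?thesis using * by (intro exI[of _ "hmonom 2 (c i j)"] exI[of _ 0]) simp
    next
      assume "bs i j = 2 * j + 1"
      then show ?thesis using * by (intro exI[of _ 0] exI[of _ "hmonom 2 (c i j)"]) simp
    qed
  qed
  then obtain a b where ab: "\<And>i j. hint (a i j)" "\<And>i j. res (a i j) = 0" "\<And>i j. hint (b i j)" "\<And>i j. res (b i j) = 0"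
    "\<And>i j x. hmonom 2 (c i j) * x (bs i j) = a i j * x (2 * j) + b i j * x (2 * j + 1)" by metis
  \<comment> \<open>\<open>u\<close> arises when \<open>x 5\<close> is eliminated from the equation
    for \<open>x 3\<close>, and \<open>v\<close> below when both are then eliminated from the
    equation for \<open>x 1\<close>.\<close>
  define u where "u = inverse (1 - b 2 1 * b 1 2)"
  have u: "hint u" "u * (1 - b 2 1 * b 1 2) = 1"
    using inverse_one_minus[of "b 2 1 * b 1 2"] ab by (simp_all add: u_def)
  define s where "s = b 0 1 * u * (b 1 0 + b 1 2 * b 2 0) + b 0 2 * (b 2 0 + b 2 1 * u * (b 1 0 + b 1 2 * b 2 0))"
  define v where "v = inverse (1 - s)"
  have v: "v * (1 - s) = 1" using inverse_one_minus[of s] ab u by (simp add: s_def v_def)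
  define k1 where "k1 y0 y2 y4 = a 0 1 * y2 + a 0 2 * y4 + y0" for y0 y2 y4
  define k3 where "k3 y0 y2 y4 = a 1 0 * y0 + a 1 2 * y4 + y2" for y0 y2 y4
  define k5 where "k5 y0 y2 y4 = a 2 0 * y0 + a 2 1 * y2 + y4" for y0 y2 y4
  define l3 where "l3 y0 y2 y4 = u * (k3 y0 y2 y4 + b 1 2 * k5 y0 y2 y4)" for y0 y2 y4
  define l1 where "l1 y0 y2 y4 = v * (k1 y0 y2 y4 + b 0 1 * l3 y0 y2 y4 + b 0 2 * (k5 y0 y2 y4 + b 2 1 * l3 y0 y2 y4))" for y0 y2 y4
  define m3 where "m3 y0 y2 y4 = l3 y0 y2 y4 + u * (b 1 0 + b 1 2 * b 2 0) * l1 y0 y2 y4" for y0 y2 y4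
  define m5 where "m5 y0 y2 y4 = k5 y0 y2 y4 + b 2 0 * l1 y0 y2 y4 + b 2 1 * m3 y0 y2 y4" for y0 y2 y4
  note defs = m5_def m3_def l1_def l3_def k5_def k3_def k1_def
  define f where "f r y0 y2 y4 = (if r = 0 then y0 else if r = 1 then l1 y0 y2 y4 else if r = 2 then y2
    else if r = 3 then m3 y0 y2 y4 else if r = 4 then y4 else m5 y0 y2 y4)" for r :: nat and y0 y2 y4
  \<comment> \<open>By linearity the coefficients of the even rows are the values of
    \<open>f\<close> at the unit vectors.\<close>
  have lin: "f r y0 y2 y4 = f r 1 0 0 * y0 + f r 0 1 0 * y2 + f r 0 0 1 * y4" for r y0 y2 y4
    by (simp add: f_def defs algebra_simps)
  have "x r = f r (x 0) (x 2) (x 4)" if x: "pair_relations c bs x" and r: "r < 6" for x r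
  proof -
    have D: "{..<3} - {0} = {1, 2 :: nat}" "{..<3} - {1} = {0, 2 :: nat}" "{..<3} - {2} = {0, 1 :: nat}" by auto
    have R: "x (2 * i + 1) = x (2 * i) + (\<Sum>j\<in>{..<3} - {i}. a i j * x (2 * j) + b i j * x (2 * j + 1))" if "i < 3" for i
      using x that unfolding pair_relations_def ab(5) by blast
    have E: "x 1 = k1 (x 0) (x 2) (x 4) + b 0 1 * x 3 + b 0 2 * x 5"
        "x 3 = k3 (x 0) (x 2) (x 4) + b 1 0 * x 1 + b 1 2 * x 5"
        "x 5 = k5 (x 0) (x 2) (x 4) + b 2 0 * x 1 + b 2 1 * x 3"
      using R[of 0] R[of 1] R[of 2] unfolding D k1_def k3_def k5_def by (simp_all add: algebra_simps numeral_eq_Suc)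
    let ?k1 = "k1 (x 0) (x 2) (x 4)" and ?k3 = "k3 (x 0) (x 2) (x 4)" and ?k5 = "k5 (x 0) (x 2) (x 4)"
    let ?l3 = "l3 (x 0) (x 2) (x 4)" and ?l1 = "l1 (x 0) (x 2) (x 4)"
    have "b 2 1 * x 3 = x 5 - ?k5 - b 2 0 * x 1" using E(3) by simp
    moreover have "x 3 - b 1 2 * (x 5 - ?k5 - b 2 0 * x 1) = ?k3 + b 1 2 * ?k5 + (b 1 0 + b 1 2 * b 2 0) * x 1"
      by (subst E(2)) (simp add: algebra_simps)
    moreover have "(1 - b 2 1 * b 1 2) * x 3 = x 3 - b 1 2 * (b 2 1 * x 3)" by (simp add: algebra_simps)
    ultimately have "(1 - b 2 1 * b 1 2) * x 3 = ?k3 + b 1 2 * ?k5 + (b 1 0 + b 1 2 * b 2 0) * x 1"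
      by simp
    then have "u * ((1 - b 2 1 * b 1 2) * x 3) = u * (?k3 + b 1 2 * ?k5 + (b 1 0 + b 1 2 * b 2 0) * x 1)"
      by (rule arg_cong)
    also have "\<dots> = ?l3 + u * (b 1 0 + b 1 2 * b 2 0) * x 1"
      by (simp add: l3_def algebra_simps)
    finally have x3: "x 3 = ?l3 + u * (b 1 0 + b 1 2 * b 2 0) * x 1"
      using u(2) by (simp add: mult.assoc[symmetric])
    have "(1 - s) * x 1 = ?k1 + b 0 1 * ?l3 + b 0 2 * (?k5 + b 2 1 * ?l3)"
      unfolding left_diff_distrib mult_1_left diff_eq_eq
      by (rule trans[OF E(1)[unfolded E(3), unfolded x3]]) (simp add: s_def algebra_simps)
    then have "v * ((1 - s) * x 1) = ?l1" by (simp add: l1_def)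
    then have x1: "x 1 = ?l1" using v by (simp add: mult.assoc[symmetric])
    then have x3': "x 3 = m3 (x 0) (x 2) (x 4)" using x3 by (simp add: m3_def)
    have x5: "x 5 = m5 (x 0) (x 2) (x 4)" using E(3) x1 x3' by (simp add: m5_def)
    have "r = 0 \<or> r = 1 \<or> r = 2 \<or> r = 3 \<or> r = 4 \<or> r = 5" using r by linarith
    then show ?thesis using x1 x3' x5 by (auto simp: f_def)
  qed
  then have "x r = f r 1 0 0 * x 0 + f r 0 1 0 * x 2 + f r 0 0 1 * x 4" if "pair_relations c bs x" "r < 6" for x r
    using trans[OF _ lin] that by blast
  then show ?thesis
    by (intro exI[of _ "\<lambda>r k. if k = 0 then f r 1 0 0 else if k = 1 then f r 0 1 0 else f r 0 0 1"]) simp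
qed

text \<open>The matrix is a sum of three matrices of rank at most one.\<close>

lemma rank_le_3_of_factor:
  fixes A :: "'a :: field mat" and p q :: "nat \<Rightarrow> nat \<Rightarrow> 'a"
  assumes A: "A \<in> carrier_mat m n"
    and f: "\<And>r v. r < m \<Longrightarrow> v < n \<Longrightarrow> A $$ (r, v) = p r 0 * q 0 v + p r 1 * q 1 v + p r 2 * q 2 v"
  shows "vec_space.rank m A \<le> 3"
proof -
  define M where "M k = mat m n (\<lambda>(r, v). p r k * q k v)" for k :: nat
  have M: "M k \<in> carrier_mat m n" "vec_space.rank m (M k) \<le> 1" for k
  proof -
    show c: "M k \<in> carrier_mat m n" by (simp add: M_def)
    show "vec_space.rank m (M k) \<le> 1"
      by (rule vec_space.rank_le_1_product_entries[OF c, of "\<lambda>r. p r k" "q k"]) (simp add: M_def)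
  qed
  have A_eq: "A = M 0 + M 1 + M 2"
    by (rule eq_matI) (use A f in \<open>auto simp: M_def\<close>)
  have "vec_space.rank m (M 0 + M 1 + M 2) \<le> vec_space.rank m (M 0 + M 1) + vec_space.rank m (M 2)"
    using M by (intro vec_space.rank_subadditive) auto
  moreover have "vec_space.rank m (M 0 + M 1) \<le> vec_space.rank m (M 0) + vec_space.rank m (M 1)"
    using M by (intro vec_space.rank_subadditive) auto
  ultimately show ?thesis unfolding A_eq using M(2)[of 0] M(2)[of 1] M(2)[of 2] by linarith
qed

section \<open>Proof of the theorem\<close>

text \<open>A submatrix lists its rows and columns in increasing order, \<open>rs\<close> and
  \<open>cs\<close> need not. Sorting permutations \<open>\<rho>\<close> and \<open>\<kappa>\<close>
  translate assignments between the two orders.\<close>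

lemma strict_diagonal_tropical_rank:
  assumes rs: "distinct rs" "set rs \<subseteq> {..<dim_row V}" and cs: "distinct cs" "set cs \<subseteq> {..<dim_col V}"
    and len: "length cs = length rs"
    and strict: "strict_diagonal (\<lambda>r c. V $$ (r, c)) rs cs"
  shows "length rs \<le> tropical_rank V"
proof -
  define m where "m = length rs"
  define S where "S = submatrix V (set rs) (set cs)"
  have card: "card (set rs) = m" "card (set cs) = m"
    using rs cs len by (simp_all add: distinct_card m_def)
  have "{i. i < dim_row V \<and> i \<in> set rs} = set rs" "{j. j < dim_col V \<and> j \<in> set cs} = set cs"
    using rs(2) cs(2) by blast+
  then have dims': "card {i. i < dim_row V \<and> i \<in> set rs} = m" "card {j. j < dim_col V \<and> j \<in> set cs} = m"
    using card by simp_all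
  have dims: "dim_row S = m" unfolding S_def dim_submatrix by (rule dims'(1))
  have S: "S $$ (a, b) = V $$ (pick (set rs) a, pick (set cs) b)" if "a < m" "b < m" for a b
    unfolding S_def by (rule submatrix_index) (simp_all only: dims' that)
  have perm: "\<exists>\<rho>. \<rho> permutes {..<m} \<and> (\<forall>i<m. xs ! i = pick (set xs) (\<rho> i))"
    if xs: "distinct xs" "length xs = m" for xs :: "nat list"
  proof -
    define \<rho> where "\<rho> i = (if i < m then card {a \<in> set xs. a < xs ! i} else i)" for i
    have e: "xs ! i = pick (set xs) (\<rho> i)" if "i < m" for i
      using that xs by (simp add: \<rho>_def pick_card_in_set)
    have "inj_on \<rho> {..<m}"
    proof (rule inj_onI)
      fix i j assume "i \<in> {..<m}" "j \<in> {..<m}" "\<rho> i = \<rho> j"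
      then have "xs ! i = xs ! j" "i < m" "j < m" using e[of i] e[of j] by simp_all
      then show "i = j" using xs by (simp add: nth_eq_iff_index_eq)
    qed
    moreover have "\<rho> i < m" if "i < m" for i
    proof -
      have "xs ! i \<in> set xs" using that xs(2) by simp
      then have "{a \<in> set xs. a < xs ! i} \<subset> set xs" by blast
      then have "card {a \<in> set xs. a < xs ! i} < card (set xs)" by (rule psubset_card_mono[rotated]) simp
      then show ?thesis using that xs by (simp add: \<rho>_def distinct_card)
    qed
    then have "\<rho> ` {..<m} \<subseteq> {..<m}" by auto
    ultimately have "bij_betw \<rho> {..<m} {..<m}"
      by (simp add: bij_betw_def endo_inj_surj)
    then have "\<rho> permutes {..<m}"
      by (rule bij_imp_permutes) (simp add: \<rho>_def)
    then show ?thesis using e by blast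
  qed
  obtain \<rho> where \<rho>: "\<rho> permutes {..<m}" "\<And>i. i < m \<Longrightarrow> rs ! i = pick (set rs) (\<rho> i)"
    using perm[OF rs(1) m_def[symmetric]] by blast
  obtain \<kappa> where \<kappa>: "\<kappa> permutes {..<m}" "\<And>i. i < m \<Longrightarrow> cs ! i = pick (set cs) (\<kappa> i)"
    using perm[OF cs(1) len[folded m_def]] by blast
  have less: "\<tau> i < m" if "\<tau> permutes {..<m}" "i < m" for \<tau> i
    using permutes_in_image[OF that(1), of i] that(2) by simp
  define cost where "cost \<sigma> = (\<Sum>i<m. S $$ (i, \<sigma> i))" for \<sigma>
  have cost: "cost \<sigma> = (\<Sum>i<m. V $$ (rs ! i, cs ! (inv_into UNIV \<kappa> \<circ> \<sigma> \<circ> \<rho>) i))" if \<sigma>: "\<sigma> permutes {..<m}" for \<sigma>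
  proof -
    have "cost \<sigma> = (\<Sum>i<m. S $$ (\<rho> i, \<sigma> (\<rho> i)))"
      unfolding cost_def using sum.permute[OF \<rho>(1), of "\<lambda>i. S $$ (i, \<sigma> i)"] by (simp add: o_def)
    also have "\<dots> = (\<Sum>i<m. V $$ (rs ! i, cs ! (inv_into UNIV \<kappa> \<circ> \<sigma> \<circ> \<rho>) i))"
    proof (rule sum.cong[OF refl])
      fix i assume "i \<in> {..<m}"
      then have i: "i < m" by simp
      have "\<kappa> (inv_into UNIV \<kappa> (\<sigma> (\<rho> i))) = \<sigma> (\<rho> i)" using \<kappa>(1) by (simp add: permutes_inverses)
      moreover have "inv_into UNIV \<kappa> (\<sigma> (\<rho> i)) < m"
        using less[OF permutes_inv[OF \<kappa>(1)] less[OF \<sigma> less[OF \<rho>(1) i]]] .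
      ultimately show "S $$ (\<rho> i, \<sigma> (\<rho> i)) = V $$ (rs ! i, cs ! (inv_into UNIV \<kappa> \<circ> \<sigma> \<circ> \<rho>) i)"
        using S[OF less[OF \<rho>(1) i] less[OF \<sigma> less[OF \<rho>(1) i]]] \<rho>(2)[OF i] \<kappa>(2)[of "inv_into UNIV \<kappa> (\<sigma> (\<rho> i))"] by simp
    qed
    finally show ?thesis .
  qed
  \<comment> \<open>The diagonal of the lists becomes this permutation of the sorted
    submatrix.\<close>
  define \<sigma>0 where "\<sigma>0 = \<kappa> \<circ> inv_into UNIV \<rho>"
  have \<sigma>0: "\<sigma>0 permutes {..<m}" unfolding \<sigma>0_def using \<rho>(1) \<kappa>(1) by (intro permutes_compose permutes_inv)
  have id: "inv_into UNIV \<kappa> \<circ> \<sigma>0 \<circ> \<rho> = id"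
    using \<rho>(1) \<kappa>(1) by (simp add: \<sigma>0_def fun_eq_iff permutes_inverses)
  have strict0: "cost \<sigma>0 < cost \<sigma>" if \<sigma>: "\<sigma> permutes {..<m}" "\<sigma> \<noteq> \<sigma>0" for \<sigma>
  proof -
    have p: "inv_into UNIV \<kappa> \<circ> \<sigma> \<circ> \<rho> permutes {..<m}"
      using \<rho>(1) \<kappa>(1) \<sigma>(1) by (intro permutes_compose permutes_inv)
    have "inv_into UNIV \<kappa> \<circ> \<sigma> \<circ> \<rho> \<noteq> id"
    proof
      assume "inv_into UNIV \<kappa> \<circ> \<sigma> \<circ> \<rho> = id"
      then have "inv_into UNIV \<kappa> (\<sigma> (\<rho> (inv_into UNIV \<rho> x))) = inv_into UNIV \<rho> x" for x by (simp add: fun_eq_iff)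
      then have e: "inv_into UNIV \<kappa> (\<sigma> x) = inv_into UNIV \<rho> x" for x by (simp add: permutes_inverses(1)[OF \<rho>(1)])
      have "\<sigma> x = \<sigma>0 x" for x
        unfolding \<sigma>0_def comp_def e[symmetric] by (simp add: permutes_inverses(1)[OF \<kappa>(1)])
      then show False using \<sigma>(2) by blast
    qed
    from strict[unfolded strict_diagonal_def, folded m_def, rule_format, OF p this]
    show ?thesis unfolding cost[OF \<sigma>(1)] cost[OF \<sigma>0] id by simp
  qed
  have "trop_nonsingular S"
    unfolding trop_nonsingular_def dims cost_def[symmetric]
  proof (rule ex1I[of _ \<sigma>0], intro conjI allI impI)
    show "cost \<sigma>0 \<le> cost \<tau>" if "\<tau> permutes {..<m}" for \<tau>
      using strict0[OF that] by (cases "\<tau> = \<sigma>0") auto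
    show "\<sigma> = \<sigma>0" if "\<sigma> permutes {..<m} \<and> (\<forall>\<tau>. \<tau> permutes {..<m} \<longrightarrow> cost \<sigma> \<le> cost \<tau>)" for \<sigma>
      using that strict0[of \<sigma>] \<sigma>0 by (meson not_le)
  qed (rule \<sigma>0)
  then have "m \<in> {r. \<exists>I J. I \<subseteq> {..<dim_row V} \<and> J \<subseteq> {..<dim_col V} \<and>
     card I = r \<and> card J = r \<and> trop_nonsingular (submatrix V I J)}"
    using card rs(2) cs(2) unfolding S_def by blast
  then show ?thesis
    unfolding tropical_rank_def m_def using finite_tropical_rank_set by (intro Max_ge) auto
qed

text \<open>Each assignment uses every column once, so the shifts \<open>\<mu>\<close> contribute
  the same total to all of them.\<close>

lemma strict_diagonal_shift:
  assumes "strict_diagonal (\<lambda>r c. V r c - \<mu> c) rs cs" "length cs = length rs"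
  shows "strict_diagonal V rs cs"
  unfolding strict_diagonal_def
proof (intro allI impI)
  fix \<tau> assume \<tau>: "\<tau> permutes {..<length rs}" "\<tau> \<noteq> id"
  have "(\<Sum>i<length rs. \<mu> (cs ! \<tau> i)) = (\<Sum>i<length rs. \<mu> (cs ! i))"
    using sum.permute[OF \<tau>(1), of "\<lambda>i. \<mu> (cs ! i)"] by (simp add: o_def)
  then show "(\<Sum>i<length rs. V (rs ! i) (cs ! i)) < (\<Sum>i<length rs. V (rs ! i) (cs ! \<tau> i))"
    using assms(1)[unfolded strict_diagonal_def, rule_format, OF \<tau>] by (simp add: sum_subtractf)
qed

section \<open>Simultaneous choice of all relations\<close>

context pair_columns
begin

lemma ex_parameters:
  "\<exists>c bs. (\<forall>Q. 0 < c Q) \<and> (\<forall>Q. bs Q div 2 = Q) \<and>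
     (\<forall>Q R. P < 3 \<longrightarrow> Q < 3 \<longrightarrow> R < 3 \<longrightarrow> P \<noteq> Q \<longrightarrow> P \<noteq> R \<longrightarrow> Q \<noteq> R \<longrightarrow> pair_fits W col P Q R (c Q) (c R) (bs R))"
proof (cases "P < 3")
  case True
  then obtain Q R where QR: "Q < 3" "R < 3" "P \<noteq> Q" "P \<noteq> R" "Q \<noteq> R"
    and all: "\<And>x. x < 3 \<Longrightarrow> x = P \<or> x = Q \<or> x = R"
  proof -
    consider "P = 0" | "P = 1" | "P = 2" using True by linarith
    then show thesis
    proof cases
      case 1
      show ?thesis by (rule that[of 1 2]) (use 1 in auto)
    next
      case 2
      show ?thesis by (rule that[of 0 2]) (use 2 in auto)
    next
      case 3
      show ?thesis by (rule that[of 0 1]) (use 3 in auto)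
    qed
  qed
  obtain D F i k where *: "0 < D" "0 < F" "i div 2 = Q" "k div 2 = R"
    "pair_fits W col P Q R D F k" "pair_fits W col P R Q F D i"
    using ex_pair_fits[OF True QR] by blast
  define c where "c x = (if x = Q then D else if x = R then F else 1)" for x
  define bs where "bs x = (if x = Q then i else if x = R then k else 2 * x)" for x
  have v: "c Q = D" "c R = F" "bs Q = i" "bs R = k" using QR by (simp_all add: c_def bs_def)
  have "pair_fits W col P Q' R' (c Q') (c R') (bs R')"
    if "Q' < 3" "R' < 3" "P \<noteq> Q'" "P \<noteq> R'" "Q' \<noteq> R'" for Q' R'
  proof -
    have "Q' = Q \<and> R' = R \<or> Q' = R \<and> R' = Q" using all[OF that(1)] all[OF that(2)] that by blast
    then show ?thesis using *(5,6) by (elim disjE conjE) (simp_all only: v)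
  qed
  moreover have "0 < c x" "bs x div 2 = x" for x using * by (simp_all add: c_def bs_def)
  ultimately show ?thesis by blast
next
  \<comment> \<open>A default for indices outside the three pairs lets the parameters be chosen for
    all natural numbers at once.\<close>
  case False
  then show ?thesis by (intro exI[of _ "\<lambda>_. 1"] exI[of _ "\<lambda>Q. 2 * Q"]) simp
qed

text \<open>The parameters of the three relations are chosen independently. A column of type
  \<open>T\<close> then needs only the conditions for the other two pairs, since its lift on
  \<open>T\<close> defines \<open>\<tau>\<close> by the relation for \<open>T\<close>.\<close>

lemma ex_lifts:
  "\<exists>c bs. (\<forall>i j. 0 < c i j) \<and> (\<forall>i j. bs i j div 2 = j) \<and>
    (\<forall>v\<in>col 0 \<union> col 1 \<union> col 2. \<exists>x. (\<forall>r<6. hdeg (x r) = ereal (W r v)) \<and> pair_relations c bs x)"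
proof -
  obtain c bs where c: "\<And>i j. 0 < c i j" and bs: "\<And>i j. bs i j div 2 = j"
    and f: "\<And>P Q R. \<lbrakk>P < 3; Q < 3; R < 3; P \<noteq> Q; P \<noteq> R; Q \<noteq> R\<rbrakk> \<Longrightarrow> pair_fits W col P Q R (c P Q) (c P R) (bs P R)"
  proof -
    define ok where "ok P c bs \<longleftrightarrow> (\<forall>Q. 0 < c Q) \<and> (\<forall>Q. bs Q div 2 = Q) \<and>
      (\<forall>Q R. P < 3 \<longrightarrow> Q < 3 \<longrightarrow> R < 3 \<longrightarrow> P \<noteq> Q \<longrightarrow> P \<noteq> R \<longrightarrow> Q \<noteq> R \<longrightarrow> pair_fits W col P Q R (c Q) (c R) (bs R))"
      for P c and bs :: "nat \<Rightarrow> nat"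
    have "\<exists>c bs. ok P c bs" for P unfolding ok_def by (rule ex_parameters)
    then obtain c bs where "\<And>P. ok P (c P) (bs P)" by metis
    then show thesis by (intro that[of c bs]) (simp_all add: ok_def)
  qed
  have "\<exists>x. (\<forall>r<6. hdeg (x r) = ereal (W r v)) \<and> pair_relations c bs x"
    if TPQ: "T < 3" "P < 3" "Q < 3" "T \<noteq> P" "T \<noteq> Q" "P \<noteq> Q" and v: "v \<in> col T" for T P Q v
  proof (rule column_lift[OF TPQ c bs])
    show "W r v = 0" if "r div 2 = T" for r using zero[OF TPQ(1) v that] .
    show "0 < W r v" if "r div 2 \<in> {P, Q}" for r
      using pos[OF TPQ(1,2) TPQ(4)[symmetric] v] pos[OF TPQ(1,3) TPQ(5)[symmetric] v] that by blast
    show "fits_at (\<lambda>r. W r v) P Q (c P T) (c P Q) (bs P Q)" "fits_at (\<lambda>r. W r v) Q P (c Q T) (c Q P) (bs Q P)"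
      using f[OF TPQ(2,1,3) TPQ(4)[symmetric] TPQ(6,5)] f[OF TPQ(3,1,2) TPQ(5)[symmetric] TPQ(6)[symmetric] TPQ(4)] v
      unfolding pair_fits_def by blast+
  qed
  note lift = this[of 0 1 2] this[of 1 0 2] this[of 2 0 1]
  have "\<exists>x. (\<forall>r<6. hdeg (x r) = ereal (W r v)) \<and> pair_relations c bs x"
    if "v \<in> col 0 \<union> col 1 \<union> col 2" for v
  proof -
    from that consider "v \<in> col 0" | "v \<in> col 1" | "v \<in> col 2" by blast
    then show ?thesis by cases (rule lift; simp)+
  qed
  then show ?thesis using c bs by blast
qed

end

theorem theorem3p12:
  shows "\<not> (\<exists>(n :: nat) (V :: real mat).
    V \<in> carrier_mat 6 n \<and>
    tropical_rank V = 3 \<and>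
    kapranov_rank V > 3 \<and>
    (\<forall>u<6. \<exists>v<n. pattern V $$ (u, v) = 0) \<and>
    (\<forall>v<n. column_support (pattern V) v \<in> {{0, 1}, {2, 3}, {4, 5}}))"
proof
  assume "\<exists>(n :: nat) (V :: real mat).
    V \<in> carrier_mat 6 n \<and>
    tropical_rank V = 3 \<and>
    kapranov_rank V > 3 \<and>
    (\<forall>u<6. \<exists>v<n. pattern V $$ (u, v) = 0) \<and>
    (\<forall>v<n. column_support (pattern V) v \<in> {{0, 1}, {2, 3}, {4, 5}})"
  then obtain n V where V: "V \<in> carrier_mat 6 n" and tr: "tropical_rank V = 3" and kr: "kapranov_rank V > 3"
    and rows: "\<forall>u<6. \<exists>v<n. pattern V $$ (u, v) = 0"
    and cols': "\<forall>v<n. column_support (pattern V) v \<in> {{0, 1}, {2, 3}, {4, 5}}"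
    by (elim exE conjE) (rule that; assumption)
  note cols = cols'[rule_format]
  have dims: "dim_row V = 6" "dim_col V = n" using V by auto
  define \<mu> where "\<mu> v = Min ((\<lambda>i. V $$ (i, v)) ` {..<6})" for v
  define W where "W r v = V $$ (r, v) - \<mu> v" for r v
  define col where "col P = {v. v < n \<and> column_support (pattern V) v = {2 * P, 2 * P + 1}}" for P
  have nonneg: "0 \<le> W r v" if "r < 6" for r v
    using that unfolding W_def \<mu>_def by (simp add: Min_le)
  have supp: "r \<in> column_support (pattern V) v \<longleftrightarrow> W r v = 0" if "r < 6" "v < n" for r v
    using that dims by (auto simp: column_support_def pattern_def W_def \<mu>_def)
  have colI: "v \<in> col (r div 2)" if r: "r < 6" "v < n" "W r v = 0" for r v
  proof -
    have "r \<in> column_support (pattern V) v" using supp r by blast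
    moreover have "column_support (pattern V) v = {0, 1} \<or> column_support (pattern V) v = {2, 3} \<or>
        column_support (pattern V) v = {4, 5}" using cols[OF r(2)] by blast
    moreover have "r div 2 = 0 \<and> {0, 1} = {2 * (r div 2), 2 * (r div 2) + 1}" if "r \<in> {0, 1}"
      using that by auto
    moreover have "r div 2 = 1 \<and> {2, 3} = {2 * (r div 2), 2 * (r div 2) + 1}" if "r \<in> {2, 3}"
      using that by auto
    moreover have "r div 2 = 2 \<and> {4, 5} = {2 * (r div 2), 2 * (r div 2) + 1}" if "r \<in> {4, 5}"
      using that by auto
    ultimately have "column_support (pattern V) v = {2 * (r div 2), 2 * (r div 2) + 1}"
      by metis
    then show ?thesis using r(2) by (simp add: col_def)
  qed
  have colD: "v < n" "W r v = 0 \<longleftrightarrow> r div 2 = P" if "v \<in> col P" "r < 6" for P r v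
  proof -
    show v: "v < n" using that by (simp add: col_def)
    have "W r v = 0 \<longleftrightarrow> r \<in> {2 * P, 2 * P + 1}" using supp[OF that(2) v] that(1) by (simp add: col_def)
    also have "\<dots> \<longleftrightarrow> r div 2 = P" unfolding insert_iff empty_iff by presburger
    finally show "W r v = 0 \<longleftrightarrow> r div 2 = P" .
  qed
  interpret pair_columns W col
  proof
    show "finite (col P)" for P by (simp add: col_def)
    show "col P \<noteq> {}" if "P < 3" for P
    proof -
      \<comment> \<open>Each row of the pattern contains a zero, hence each of the three supports
        occurs.\<close>
      have "2 * P < 6" using that by simp
      moreover from this obtain v where "v < n" "pattern V $$ (2 * P, v) = 0" using rows by blast
      ultimately have "v \<in> col P" using colI[of "2 * P" v] supp[of "2 * P" v] dims
        by (simp add: column_support_def pattern_def)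
      then show ?thesis by blast
    qed
    show "W r w = 0" if "P < 3" "w \<in> col P" "r div 2 = P" for P r w
      using colD(2)[of w P r] that by auto
    show "0 < W r w" if "P < 3" "Q < 3" "Q \<noteq> P" "w \<in> col P" "r div 2 = Q" for P Q r w
    proof -
      have "r < 6" using that by auto
      then show ?thesis using colD(2)[of w P r] nonneg[of r w] that by auto
    qed
    show False if "length rs = 4" "length cs = 4" "distinct rs" "distinct cs" "set rs \<subseteq> {..<6}"
        "set cs \<subseteq> col 0 \<union> col 1 \<union> col 2" "strict_diagonal W rs cs" for rs cs
    proof -
      have "strict_diagonal (\<lambda>r c. V $$ (r, c)) rs cs"
        by (rule strict_diagonal_shift[where \<mu> = \<mu>]) (use that in \<open>simp_all add: W_def[abs_def]\<close>)
      moreover have "set cs \<subseteq> {..<dim_col V}" using that(6) dims by (auto simp: col_def)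
      ultimately have "length rs \<le> tropical_rank V"
        using strict_diagonal_tropical_rank[of rs V cs] that dims by simp
      then show False using that tr by simp
    qed
  qed
  have mem: "v \<in> col 0 \<union> col 1 \<union> col 2" if "v < n" for v
  proof -
    have e: "{2 * 0, 2 * 0 + 1} = {0, 1 :: nat}" "{2 * 1, 2 * 1 + 1} = {2, 3 :: nat}" "{2 * 2, 2 * 2 + 1} = {4, 5 :: nat}"
      by simp_all
    have "column_support (pattern V) v = {0, 1} \<or> column_support (pattern V) v = {2, 3} \<or>
        column_support (pattern V) v = {4, 5}" using cols[OF that] by blast
    then have "v \<in> col 0 \<or> v \<in> col 1 \<or> v \<in> col 2"
      using that unfolding col_def mem_Collect_eq e by simp
    then show ?thesis by simp
  qed
  obtain c bs where c: "\<And>i j. 0 < c i j" "\<And>i j. bs i j div 2 = j"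
    and "\<forall>v\<in>col 0 \<union> col 1 \<union> col 2. \<exists>x. (\<forall>r<6. hdeg (x r) = ereal (W r v)) \<and> pair_relations c bs x"
    using ex_lifts by blast
  then obtain x where x: "\<And>v r. v < n \<Longrightarrow> r < 6 \<Longrightarrow> hdeg (x v r) = ereal (W r v)"
    "\<And>v. v < n \<Longrightarrow> pair_relations c bs (x v)"
    using mem by metis
  obtain p :: "nat \<Rightarrow> nat \<Rightarrow> hahn" where p: "\<forall>x. pair_relations c bs x \<longrightarrow>
      (\<forall>r<6. x r = p r 0 * x 0 + p r 1 * x 2 + p r 2 * x 4)"
    using pair_relations_factor[of c bs, OF c] by (elim exE) (rule that)
  \<comment> \<open>Multiplying each column by the monomial of degree \<open>\<mu> v\<close> undoes
    the normalization and preserves the linear dependence of the rows.\<close>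
  define A where "A = mat 6 n (\<lambda>(r, v). hmonom 1 (\<mu> v) * x v r)"
  have A: "A \<in> carrier_mat 6 n" by (simp add: A_def)
  have deg: "hdeg (A $$ (r, v)) = ereal (V $$ (r, v))" if "r < 6" "v < n" for r v
    using hdeg_shift[OF x(1)[OF that(2,1)], of "\<mu> v"] that by (simp add: A_def W_def)
  have "vec_space.rank 6 A \<le> 3"
  proof (rule rank_le_3_of_factor[OF A, of p "\<lambda>k v. hmonom 1 (\<mu> v) * x v (2 * k)"])
    show "A $$ (r, v) = p r 0 * (hmonom 1 (\<mu> v) * x v (2 * 0)) + p r 1 * (hmonom 1 (\<mu> v) * x v (2 * 1)) +
        p r 2 * (hmonom 1 (\<mu> v) * x v (2 * 2))" if "r < 6" "v < n" for r v
    proof -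
      have "A $$ (r, v) = hmonom 1 (\<mu> v) * (p r 0 * x v 0 + p r 1 * x v 2 + p r 2 * x v 4)"
        using p[rule_format, OF x(2)[OF that(2)] that(1)] that by (simp add: A_def)
      then show ?thesis by (simp add: algebra_simps numeral_eq_Suc)
    qed
  qed
  moreover have "kapranov_rank V \<le> vec_space.rank 6 A"
    unfolding kapranov_rank_def dims by (rule Least_le) (use A deg in blast)
  ultimately show False using kr by simp
qed

end
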